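(* Let $M$ be a connected matroid of rank $r(M)$ and nullity $m=|E(M)|-r(M)$. Then $M$ is a lattice path matroid if and only if the following properties hold. (i) The fundamental flats of $M$ form at most two disjoint chains under inclusion, say $F_1\subset F_2\subset\cdots\subset F_h$ and $G_1\subset G_2\subset\cdots\subset G_k$. (ii) If $F_i\cap G_j\neq\emptyset$, then $F_i\cup G_j=E(M)$. (iii) The proper nontrivial connected flats of $M$ are precisely the following sets: (a) $F_1,\ldots,F_h,G_1,\ldots,G_k$, and (b) the intersections $F_i\cap G_j$ for which the inequality $m<\eta(F_i)+\eta(G_j)$ holds. (iv) The rank of each flat $F_i\cap G_j$ of item (iii)(b) is $r(F_i)+r(G_j)-r(M)$.
   Context: Lattice paths start at $(0,0)$ and use steps $E=(1,0)$ and $N=(0,1)$. For lattice paths $P,Q$ from $(0,0)$ to $(m,r)$ with $P$ never going above $Q$, let $\mathcal{P}$ be the set of lattice paths from $(0,0)$ to $(m,r)$ going neither above $Q$ nor below $P$, and for $1\le i\le r$ let $N_i=\{j:\text{step } j \text{ is the } i\text{-th North step of some path in }\mathcal{P}\}$. The matroid $M[P,Q]$ is the transversal matroid on $[m+r]=\{1,\ldots,m+r\}$ with presentation $(N_1,\ldots,N_r)$; a lattice path matroid is a matroid isomorphic to some $M[P,Q]$. For a set $X$, $\eta(X)=|X|-r(X)$ is its nullity. A flat $X$ is connected if $M|X$ is connected, and nontrivial if $X$ is dependent. A fundamental flat of a connected matroid $M$ is a connected flat $X$ with $|X|>1$ and $r(X)<r(M)$ such that for some spanning circuit $C$ of $M$,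 $X\cap C$ is a basis of $M|X$. *)

theory Defs
  imports Main
begin

section \<open>Finite matroids\<close>

locale matroid =
  fixes E :: "'a set" and indep :: "'a set \<Rightarrow> bool"
  assumes finite_ground: "finite E"
    and indep_subset_ground: "indep X \<Longrightarrow> X \<subseteq> E"
    and indep_empty: "indep {}"
    and indep_mono: "indep Y \<Longrightarrow> X \<subseteq> Y \<Longrightarrow> indep X"
    and indep_augment: "indep X \<Longrightarrow> indep Y \<Longrightarrow> card X < card Y \<Longrightarrow>
                          \<exists>e\<in>Y - X. indep (insert e X)"

text \<open>The notions below take the ground set and the independence predicate as explicit
  arguments, so that they apply to restrictions as well.\<close>

definition rank :: "('a set \<Rightarrow> bool) \<Rightarrow> 'a set \<Rightarrow> nat" where
  "rank indep X = Max (card ` {Y. Y \<subseteq> X \<and> indep Y})"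

text \<open>The subtraction does not truncate for finite \<open>X\<close>.\<close>

definition nullity :: "('a set \<Rightarrow> bool) \<Rightarrow> 'a set \<Rightarrow> nat" where
  "nullity indep X = card X - rank indep X"

definition basis :: "'a set \<Rightarrow> ('a set \<Rightarrow> bool) \<Rightarrow> 'a set \<Rightarrow> bool" where
  "basis E indep B \<longleftrightarrow>
     B \<subseteq> E \<and> indep B \<and> (\<forall>B'. B \<subseteq> B' \<and> B' \<subseteq> E \<and> indep B' \<longrightarrow> B' = B)"

definition circuit :: "'a set \<Rightarrow> ('a set \<Rightarrow> bool) \<Rightarrow> 'a set \<Rightarrow> bool" where
  "circuit E indep C \<longleftrightarrow> C \<subseteq> E \<and> \<not> indep C \<and> (\<forall>D. D \<subset> C \<longrightarrow> indep D)"

definition spanning_circuit :: "'a set \<Rightarrow> ('a set \<Rightarrow> bool) \<Rightarrow> 'a set \<Rightarrow> bool" where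
  "spanning_circuit E indep C \<longleftrightarrow> circuit E indep C \<and> rank indep C = rank indep E"

definition flat :: "'a set \<Rightarrow> ('a set \<Rightarrow> bool) \<Rightarrow> 'a set \<Rightarrow> bool" where
  "flat E indep X \<longleftrightarrow> X \<subseteq> E \<and> (\<forall>e\<in>E - X. rank indep X < rank indep (insert e X))"

text \<open>Independence in the restriction to \<open>X\<close>, whose ground set is \<open>X\<close>.\<close>

definition restrict_indep :: "('a set \<Rightarrow> bool) \<Rightarrow> 'a set \<Rightarrow> 'a set \<Rightarrow> bool" where
  "restrict_indep indep X Y \<longleftrightarrow> Y \<subseteq> X \<and> indep Y"

text \<open>The usual convention: matroids on at most one element are connected.\<close>

definition connected_matroid :: "'a set \<Rightarrow> ('a set \<Rightarrow> bool) \<Rightarrow> bool" where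
  "connected_matroid E indep \<longleftrightarrow>
     (\<forall>x\<in>E. \<forall>y\<in>E. x \<noteq> y \<longrightarrow> (\<exists>C. circuit E indep C \<and> x \<in> C \<and> y \<in> C))"

definition connected_flat :: "'a set \<Rightarrow> ('a set \<Rightarrow> bool) \<Rightarrow> 'a set \<Rightarrow> bool" where
  "connected_flat E indep X \<longleftrightarrow>
     flat E indep X \<and> connected_matroid X (restrict_indep indep X)"

definition nontrivial :: "('a set \<Rightarrow> bool) \<Rightarrow> 'a set \<Rightarrow> bool" where
  "nontrivial indep X \<longleftrightarrow> \<not> indep X"

definition fundamental_flat :: "'a set \<Rightarrow> ('a set \<Rightarrow> bool) \<Rightarrow> 'a set \<Rightarrow> bool" where
  "fundamental_flat E indep X \<longleftrightarrow>
     connected_flat E indep X \<and> 1 < card X \<and> rank indep X < rank indep E \<and>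
     (\<exists>C. spanning_circuit E indep C \<and> basis X (restrict_indep indep X) (X \<inter> C))"

definition matroid_iso ::
  "'a set \<Rightarrow> ('a set \<Rightarrow> bool) \<Rightarrow> 'b set \<Rightarrow> ('b set \<Rightarrow> bool) \<Rightarrow> bool" where
  "matroid_iso E indep E' indep' \<longleftrightarrow>
     (\<exists>f. bij_betw f E E' \<and> (\<forall>X. X \<subseteq> E \<longrightarrow> (indep X \<longleftrightarrow> indep' (f ` X))))"

section \<open>Lattice paths and lattice path matroids\<close>

datatype step = East | North

definition lattice_path :: "nat \<Rightarrow> nat \<Rightarrow> step list \<Rightarrow> bool" where
  "lattice_path m r P \<longleftrightarrow> count_list P East = m \<and> count_list P North = r"

definition path_points :: "step list \<Rightarrow> (nat \<times> nat) set" where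
  "path_points P =
     {(count_list (take j P) East, count_list (take j P) North) | j. j \<le> length P}"

text \<open>Compare heights on each vertical line through lattice points. For paths with common
  endpoints this decides the relative position of the full polygonal paths: strictly between
  two such lines a path is a single East step, whose height is the largest height of the path
  on the left line and the smallest one on the right line.\<close>

definition goes_above :: "step list \<Rightarrow> step list \<Rightarrow> bool" where
  "goes_above P Q \<longleftrightarrow>
     (\<exists>x y. (x, y) \<in> path_points P \<and> (\<forall>y'. (x, y') \<in> path_points Q \<longrightarrow> y' < y))"

definition goes_below :: "step list \<Rightarrow> step list \<Rightarrow> bool" where
  "goes_below P Q \<longleftrightarrow>
     (\<exists>x y. (x, y) \<in> path_points P \<and> (\<forall>y'. (x, y') \<in> path_points Q \<longrightarrow> y < y'))"

definition paths_between ::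
  "nat \<Rightarrow> nat \<Rightarrow> step list \<Rightarrow> step list \<Rightarrow> step list set" where
  "paths_between m r P Q =
     {R. lattice_path m r R \<and> \<not> goes_above R Q \<and> \<not> goes_below R P}"

text \<open>Steps are numbered from 1, whereas list positions start at 0.\<close>

definition ith_north_step :: "step list \<Rightarrow> nat \<Rightarrow> nat \<Rightarrow> bool" where
  "ith_north_step R i j \<longleftrightarrow>
     1 \<le> j \<and> j \<le> length R \<and> R ! (j - 1) = North \<and> count_list (take j R) North = i"

definition north_set :: "nat \<Rightarrow> nat \<Rightarrow> step list \<Rightarrow> step list \<Rightarrow> nat \<Rightarrow> nat set" where
  "north_set m r P Q i = {j. \<exists>R\<in>paths_between m r P Q. ith_north_step R i j}"

text \<open>The independent sets of the transversal matroid on \<open>S\<close> with presentation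
  \<open>(A i)\<close>, \<open>i \<in> J\<close>, are the partial transversals of this family.\<close>

definition transversal_indep :: "'a set \<Rightarrow> 'i set \<Rightarrow> ('i \<Rightarrow> 'a set) \<Rightarrow> 'a set \<Rightarrow> bool" where
  "transversal_indep S J A X \<longleftrightarrow>
     X \<subseteq> S \<and> (\<exists>f. inj_on f X \<and> f ` X \<subseteq> J \<and> (\<forall>x\<in>X. x \<in> A (f x)))"

text \<open>The independence predicate of \<open>M[P,Q]\<close>, whose ground set is \<open>{1..m + r}\<close>.\<close>

definition lpm_indep :: "nat \<Rightarrow> nat \<Rightarrow> step list \<Rightarrow> step list \<Rightarrow> nat set \<Rightarrow> bool" where
  "lpm_indep m r P Q = transversal_indep {1..m + r} {1..r} (north_set m r P Q)"

definition lattice_path_matroid :: "'a set \<Rightarrow> ('a set \<Rightarrow> bool) \<Rightarrow> bool" where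
  "lattice_path_matroid E indep \<longleftrightarrow>
     (\<exists>m r P Q. lattice_path m r P \<and> lattice_path m r Q \<and> \<not> goes_above P Q \<and>
        matroid_iso E indep {1..m + r} (lpm_indep m r P Q))"

end

(*
  Writing p and q for the height functions of P and Q, a set I is independent in M[P,Q] iff every
  interval of positions a+1..b contains at most q b - p a elements of I.  So M is a lattice path
  matroid iff its elements can be ordered such that independence is given by such inequalities.

  Such an order forces the structure of the flats.  The interval a+1..b has rank
  min (b - a) (q b - p a), and a circuit spans an interval containing it, so nontrivial connected
  flats are intervals.  Comparing ranks at their ends shows that they end at 0, at n or at corners
  of the paths.  Those bounded by two corners are not fundamental, because a spanning circuit needs
  more than p a elements before a and more than r - q b elements after b.

  Conversely, (ii) says that the F_i and the complements of the G_j form a single chain.  Order E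
  along it and let q k be the rank of the first k elements, and r - p k that of the others.
  Submodularity yields the inequalities for independent sets.  If I satisfies them, then by
  (iii) and (iv) it meets every nontrivial connected flat X in at most r(X) elements, so it is
  independent: a circuit C in I would violate this at its closure.
*)
theory Submission
  imports Defs
begin

section \<open>Rank, closure and circuits\<close>

text \<open>For any order of the elements let \<open>q k\<close> and \<open>p k\<close> be the
  largest and the least number of elements that a basis has among the first \<open>k\<close>. A
  basis has at most \<open>q b - p a\<close> elements at positions \<open>a + 1..b\<close>, so the
  inequalities are necessary in every matroid; the question is when they suffice. For lattice path
  matroids this is a matching argument, carried out by one greedy path. For an abstract matroid it
  reduces to finitely many sets, because the ranks of the nontrivial connected flats determine
  independence.

  Connectedness of \<open>M\<close> enters through two facts: there are no loops once there are two
  elements, and the boundary paths do not touch between their ends. The latter makes a dependent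
  segment between corners connected, each cut inside it being crossed by a circuit, and it turns the
  North steps of \<open>Q\<close> together with the last element into a spanning circuit.

  The inequality on nullities in (iii) says that the segment \<open>a + 1..b\<close>, the
  intersection of two flats, has more than \<open>q b - p a\<close> elements; its rank is then
  \<open>q b - p a\<close>, as (iv) demands.\<close>

context matroid
begin

section \<open>Rank and submodularity\<close>

lemma indep_finite: "indep X \<Longrightarrow> finite X"
  using finite_ground indep_subset_ground finite_subset by blast

lemma finite_indeps: "finite {Y. Y \<subseteq> X \<and> indep Y}"
  by (rule finite_subset[of _ "Pow E"]) (auto dest: indep_subset_ground simp: finite_ground)

lemma rank_witness:
  obtains B where "B \<subseteq> X" "indep B" "card B = rank indep X"
proof -
  have "rank indep X \<in> card ` {Y. Y \<subseteq> X \<and> indep Y}"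
    unfolding rank_def using finite_indeps indep_empty by (intro Max_in) auto
  then show ?thesis using that by auto
qed

lemma card_le_rank: "Y \<subseteq> X \<Longrightarrow> indep Y \<Longrightarrow> card Y \<le> rank indep X"
  unfolding rank_def using finite_indeps by (intro Max_ge) auto

lemma rank_mono: "X \<subseteq> Y \<Longrightarrow> rank indep X \<le> rank indep Y"
  by (metis card_le_rank order.trans rank_witness)

lemma rank_insert_ge: "rank indep X \<le> rank indep (insert e X)"
  by (rule rank_mono) auto

lemma rank_le_card: "finite X \<Longrightarrow> rank indep X \<le> card X"
  by (metis card_mono rank_witness)

lemma rank_indep: "indep X \<Longrightarrow> rank indep X = card X"
  by (simp add: card_le_rank indep_finite order_antisym rank_le_card)

lemma indep_if_card_le_rank: "finite X \<Longrightarrow> card X \<le> rank indep X \<Longrightarrow> indep X"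
  by (metis card_seteq rank_witness)

lemma basis_extend:
  assumes "indep Y" "Y \<subseteq> X"
  obtains B where "Y \<subseteq> B" "B \<subseteq> X" "indep B" "card B = rank indep X"
proof -
  let ?S = "{B. Y \<subseteq> B \<and> B \<subseteq> X \<and> indep B}"
  have fin: "finite ?S" by (rule finite_subset[OF _ finite_indeps[of X]]) auto
  have ne: "?S \<noteq> {}" using assms by auto
  obtain B where B: "B \<in> ?S" "\<And>B'. B' \<in> ?S \<Longrightarrow> B \<subseteq> B' \<Longrightarrow> B = B'"
    using finite_has_maximal[OF fin ne] by auto
  obtain D where D: "D \<subseteq> X" "indep D" "card D = rank indep X" by (rule rank_witness)
  have "\<not> card B < card D"
  proof
    assume "card B < card D"
    then obtain e where "e \<in> D - B" "indep (insert e B)" using indep_augment B(1) D by blast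
    then show False using B(2)[of "insert e B"] B(1) D(1) by auto
  qed
  then have "card B = rank indep X" using card_le_rank[of B X] B(1) D(3) by auto
  then show ?thesis using that B(1) by auto
qed

text \<open>Extend a basis \<open>I\<close> of the intersection to a basis \<open>J\<close> of the
  union. The parts \<open>J \<inter> A\<close> and \<open>J \<inter> B\<close> are independent and
  both contain \<open>I\<close>, so together they have at least \<open>card J + card I\<close>
  elements.\<close>

lemma rank_submodular:
  "rank indep (A \<union> B) + rank indep (A \<inter> B) \<le> rank indep A + rank indep B"
proof -
  obtain I where I: "I \<subseteq> A \<inter> B" "indep I" "card I = rank indep (A \<inter> B)" by (rule rank_witness)
  obtain J where J: "I \<subseteq> J" "J \<subseteq> A \<union> B" "indep J" "card J = rank indep (A \<union> B)"
    by (rule basis_extend[of I "A \<union> B"]) (use I in auto)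
  have fin: "finite J" using J(3) by (rule indep_finite)
  have iA: "indep (J \<inter> A)" and iB: "indep (J \<inter> B)"
    by (rule indep_mono[OF J(3)]; simp)+
  have "card J + card I \<le> card (J \<inter> A \<union> J \<inter> B) + card ((J \<inter> A) \<inter> (J \<inter> B))"
    using J(1,2) I(1) fin by (intro add_mono card_mono) auto
  also have "\<dots> = card (J \<inter> A) + card (J \<inter> B)"
    using card_Un_Int[of "J \<inter> A" "J \<inter> B"] fin by simp
  also have "\<dots> \<le> rank indep A + rank indep B"
    using iA iB by (intro add_mono card_le_rank) auto
  finally show ?thesis using I J by simp
qed

section \<open>Closure and flats\<close>

definition cl :: "'a set \<Rightarrow> 'a set" where
  "cl A = {x \<in> E. rank indep (insert x A) = rank indep A}"

lemma cl_subset_ground: "cl A \<subseteq> E"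
  by (auto simp: cl_def)

lemma subset_cl: "A \<subseteq> E \<Longrightarrow> A \<subseteq> cl A"
  by (auto simp: cl_def insert_absorb)

lemma cl_mono:
  assumes "A \<subseteq> B" shows "cl A \<subseteq> cl B"
proof
  fix x assume "x \<in> cl A"
  then have x: "x \<in> E" "rank indep (insert x A) = rank indep A" by (auto simp: cl_def)
  have "rank indep A \<le> rank indep (B \<inter> insert x A)" using assms by (intro rank_mono) auto
  moreover have "B \<union> insert x A = insert x B" using assms by auto
  ultimately have "rank indep (insert x B) \<le> rank indep B"
    using rank_submodular[of B "insert x A"] x(2) by simp
  then show "x \<in> cl B" using x(1) rank_insert_ge[of B x] by (simp add: cl_def)
qed

text \<open>Membership in \<open>cl A\<close> speaks of one added element at a time. If all of
  \<open>Z\<close> together raised the rank, augmenting a basis of \<open>A\<close> from one of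
  \<open>A \<union> Z\<close> would exhibit a single element that raises it.\<close>

lemma rank_Un_cl:
  assumes "Z \<subseteq> cl A" shows "rank indep (A \<union> Z) = rank indep A"
proof (rule antisym[OF leI rank_mono])
  show "\<not> rank indep A < rank indep (A \<union> Z)"
  proof
    assume less: "rank indep A < rank indep (A \<union> Z)"
    obtain B where B: "B \<subseteq> A" "indep B" "card B = rank indep A" by (rule rank_witness)
    obtain D where D: "D \<subseteq> A \<union> Z" "indep D" "card D = rank indep (A \<union> Z)" by (rule rank_witness)
    obtain e where e: "e \<in> D - B" "indep (insert e B)"
      using indep_augment[OF B(2) D(2)] less B(3) D(3) by auto
    then have "card (insert e B) \<le> rank indep (insert e A)" using B by (intro card_le_rank) auto
    then have gt: "rank indep A < rank indep (insert e A)" using e B indep_finite by auto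
    then have "e \<notin> A" by (auto simp: insert_absorb)
    then show False using gt e D(1) assms by (auto simp: cl_def)
  qed
qed auto

lemma rank_cl: "A \<subseteq> E \<Longrightarrow> rank indep (cl A) = rank indep A"
  using rank_Un_cl[of "cl A" A] subset_cl[of A] by (simp add: Un_absorb1)

lemma cl_least: "A \<subseteq> cl B \<Longrightarrow> B \<subseteq> E \<Longrightarrow> cl A \<subseteq> cl B"
proof
  fix x assume A: "A \<subseteq> cl B" and B: "B \<subseteq> E" and "x \<in> cl A"
  then have x: "x \<in> cl (cl B)" "x \<in> E" using cl_mono cl_subset_ground by blast+
  have "rank indep (insert x B) \<le> rank indep (insert x (cl B))"
    using subset_cl[OF B] by (intro rank_mono) auto
  also have "\<dots> = rank indep B" using x(1) rank_cl[OF B] by (simp add: cl_def)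
  finally show "x \<in> cl B"
    using x(2) rank_insert_ge[of B x] by (simp add: cl_def)
qed

lemma flat_iff_cl: "flat E indep X \<longleftrightarrow> X \<subseteq> E \<and> cl X \<subseteq> X"
proof -
  have "rank indep X < rank indep (insert e X) \<longleftrightarrow> rank indep (insert e X) \<noteq> rank indep X" for e
    using rank_insert_ge[of X e] by auto
  then show ?thesis by (auto simp: flat_def cl_def)
qed

lemma flat_cl: "X \<subseteq> E \<Longrightarrow> flat E indep (cl X)"
  using cl_least[of "cl X" X] by (simp add: flat_iff_cl cl_subset_ground)

section \<open>Circuits\<close>

lemma circuit_subset: "circuit E indep C \<Longrightarrow> C \<subseteq> E"
  by (simp add: circuit_def)

lemma circuit_finite: "circuit E indep C \<Longrightarrow> finite C"
  using circuit_subset finite_ground finite_subset by blast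

lemma circuit_minimal: "circuit E indep C \<Longrightarrow> x \<in> C \<Longrightarrow> indep (C - {x})"
  by (auto simp: circuit_def)

lemma circuit_not_indep: "circuit E indep C \<Longrightarrow> C \<subseteq> X \<Longrightarrow> \<not> indep X"
  using indep_mono by (auto simp: circuit_def)

lemma circuit_nonempty: "circuit E indep C \<Longrightarrow> C \<noteq> {}"
  using indep_empty by (auto simp: circuit_def)

lemma circuit_antichain: "circuit E indep C \<Longrightarrow> circuit E indep D \<Longrightarrow> C \<subseteq> D \<Longrightarrow> C = D"
  by (auto simp: circuit_def)

lemma dependent_contains_circuit:
  assumes "X \<subseteq> E" "\<not> indep X"
  obtains C where "C \<subseteq> X" "circuit E indep C"
proof -
  let ?S = "{C. C \<subseteq> X \<and> \<not> indep C}"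
  have fin: "finite ?S"
    by (rule finite_subset[of _ "Pow E"]) (use assms finite_ground in auto)
  have ne: "?S \<noteq> {}" using assms by auto
  obtain C where "C \<in> ?S" "\<And>D. D \<in> ?S \<Longrightarrow> D \<subseteq> C \<Longrightarrow> C = D"
    using finite_has_minimal[OF fin ne] by auto
  then have "circuit E indep C" using assms by (auto simp: circuit_def)
  then show ?thesis using that \<open>C \<in> ?S\<close> by auto
qed

lemma circuit_rank:
  assumes C: "circuit E indep C" shows "card C = Suc (rank indep C)"
proof -
  obtain x where x: "x \<in> C" using circuit_nonempty[OF C] by auto
  have fin: "finite C" using C by (rule circuit_finite)
  have "card (C - {x}) \<le> rank indep C"
    using circuit_minimal[OF C x] by (intro card_le_rank) auto
  moreover have "\<not> card C \<le> rank indep C"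
    using indep_if_card_le_rank[OF fin] circuit_not_indep[OF C] by auto
  ultimately show ?thesis using x fin by (simp add: card_Diff_singleton)
qed

lemma circuit_imp_cl:
  assumes C: "circuit E indep C" and x: "x \<in> C" and A: "C - {x} \<subseteq> A"
  shows "x \<in> cl A"
proof -
  have "card C = Suc (rank indep (C - {x}))"
    using rank_indep[OF circuit_minimal[OF C x]] x circuit_finite[OF C] by (simp add: card_gt_0_iff circuit_nonempty[OF C])
  then have "x \<in> cl (C - {x})"
    using circuit_rank[OF C] x circuit_subset[OF C] by (auto simp: cl_def insert_absorb)
  then show ?thesis using cl_mono[OF A] by auto
qed

lemma cl_imp_circuit:
  assumes x: "x \<in> cl A" "x \<notin> A" and A: "A \<subseteq> E"
  obtains C where "circuit E indep C" "x \<in> C" "C \<subseteq> insert x A"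
proof -
  obtain B where B: "B \<subseteq> A" "indep B" "card B = rank indep A" by (rule rank_witness)
  have "\<not> indep (insert x B)"
  proof
    assume "indep (insert x B)"
    then have "card (insert x B) \<le> rank indep (insert x A)" using B(1) by (intro card_le_rank) auto
    moreover have "x \<notin> B" using x(2) B(1) by auto
    ultimately show False using x(1) B indep_finite[OF B(2)] by (simp add: cl_def)
  qed
  moreover have "insert x B \<subseteq> E" using B(1) A x(1) by (auto simp: cl_def)
  ultimately obtain C where C: "C \<subseteq> insert x B" "circuit E indep C"
    using dependent_contains_circuit by blast
  have "x \<in> C" using circuit_not_indep[OF C(2), of B] C(1) B(2) by auto
  then show ?thesis using that C B(1) by blast
qed

text \<open>Closure replaces an exchange argument: \<open>D\<close> puts \<open>e\<close> into the
  closure of \<open>(C \<union> D) - {e, f}\<close>, hence all of \<open>C - {f}\<close> lies there,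
  hence so does \<open>f\<close>.\<close>

lemma strong_circuit_elimination:
  assumes C: "circuit E indep C" and D: "circuit E indep D"
    and e: "e \<in> C \<inter> D" and f: "f \<in> C - D"
  obtains C' where "circuit E indep C'" "f \<in> C'" "C' \<subseteq> (C \<union> D) - {e}"
proof -
  let ?A = "(C \<union> D) - {e, f}"
  have AE: "?A \<subseteq> E" using circuit_subset[OF C] circuit_subset[OF D] by auto
  have "e \<in> cl ?A" using e f by (intro circuit_imp_cl[OF D]) auto
  then have "C - {f} \<subseteq> cl ?A" using subset_cl[OF AE] by auto
  then have "cl (C - {f}) \<subseteq> cl ?A" using AE by (rule cl_least)
  moreover have "f \<in> cl (C - {f})" using f by (intro circuit_imp_cl[OF C]) auto
  ultimately have "f \<in> cl ?A" by auto
  then obtain C' where C': "circuit E indep C'" "f \<in> C'" "C' \<subseteq> insert f ?A"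
    by (rule cl_imp_circuit[of f ?A]) (use AE in auto)
  moreover have "insert f ?A \<subseteq> (C \<union> D) - {e}" using e f by auto
  ultimately show ?thesis using that by blast
qed

text \<open>Transitivity of lying on a common circuit. In a counterexample with smallest union,
  eliminate a common element \<open>e\<close> once keeping \<open>x\<close> (giving
  \<open>C3\<close>) and once keeping \<open>z\<close> (giving \<open>C4\<close>). The pair
  \<open>C\<close>, \<open>C4\<close> must have the same union, so \<open>C4\<close> contains
  \<open>D - C\<close> and meets \<open>C3\<close>; then \<open>C3\<close>, \<open>C4\<close> is a
  pair whose union misses \<open>e\<close>.\<close>

lemma circuits_meet_imp_common_circuit:
  assumes "circuit E indep C" "circuit E indep D" "x \<in> C" "z \<in> D" "C \<inter> D \<noteq> {}"
  shows "\<exists>C'. circuit E indep C' \<and> x \<in> C' \<and> z \<in> C' \<and> C' \<subseteq> C \<union> D"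
  using assms
proof (induction "card (C \<union> D)" arbitrary: C D rule: less_induct)
  case less
  note C = less.prems(1) and D = less.prems(2) and x = less.prems(3) and z = less.prems(4)
  show ?case
  proof (rule ccontr)
    assume none: "\<not> ?thesis"
    have IH: "circuit E indep C1 \<Longrightarrow> circuit E indep C2 \<Longrightarrow> x \<in> C1 \<Longrightarrow> z \<in> C2 \<Longrightarrow>
      C1 \<inter> C2 \<noteq> {} \<Longrightarrow> C1 \<union> C2 \<subseteq> C \<union> D \<Longrightarrow> C1 \<union> C2 = C \<union> D" for C1 C2
    proof (rule ccontr)
      assume *: "circuit E indep C1" "circuit E indep C2" "x \<in> C1" "z \<in> C2"
        "C1 \<inter> C2 \<noteq> {}" "C1 \<union> C2 \<subseteq> C \<union> D" "C1 \<union> C2 \<noteq> C \<union> D"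
      have "card (C1 \<union> C2) < card (C \<union> D)"
        using * circuit_finite[OF C] circuit_finite[OF D] by (intro psubset_card_mono) auto
      then show False using less.hyps[of C1 C2] * none by blast
    qed
    obtain e where e: "e \<in> C \<inter> D" using less.prems(5) by auto
    have xD: "x \<in> C - D" and zC: "z \<in> D - C" using none C D x z by blast+
    obtain C3 where C3: "circuit E indep C3" "x \<in> C3" "C3 \<subseteq> (C \<union> D) - {e}"
      by (rule strong_circuit_elimination[OF C D e xD])
    obtain C4 where C4: "circuit E indep C4" "z \<in> C4" "C4 \<subseteq> (D \<union> C) - {e}"
      by (rule strong_circuit_elimination[OF D C _ zC, of e]) (use e in auto)
    have 3: "C3 \<inter> (D - C) \<noteq> {}"
    proof
      assume "C3 \<inter> (D - C) = {}"
      then have "C3 \<subseteq> C" using C3(3) by auto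
      then show False using circuit_antichain[OF C3(1) C] C3(3) e by auto
    qed
    have 4: "C4 \<inter> (C - D) \<noteq> {}"
    proof
      assume "C4 \<inter> (C - D) = {}"
      then have "C4 \<subseteq> D" using C4(3) by auto
      then show False using circuit_antichain[OF C4(1) D] C4(3) e by auto
    qed
    have "C \<union> C4 = C \<union> D" using 4 C4 by (intro IH[OF C C4(1) x C4(2)]) auto
    then have "C3 \<inter> C4 \<noteq> {}" using 3 by blast
    then have "C3 \<union> C4 = C \<union> D" using C3 C4 by (intro IH[OF C3(1) C4(1)]) auto
    then show False using C3(3) C4(3) e by auto
  qed
qed

section \<open>Connectedness\<close>

lemma circuit_restrict:
  "X \<subseteq> E \<Longrightarrow> circuit X (restrict_indep indep X) C \<longleftrightarrow> circuit E indep C \<and> C \<subseteq> X"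
  by (auto simp: circuit_def restrict_indep_def)

lemma connected_restrict_iff:
  "X \<subseteq> E \<Longrightarrow> connected_matroid X (restrict_indep indep X) \<longleftrightarrow>
    (\<forall>x\<in>X. \<forall>y\<in>X. x \<noteq> y \<longrightarrow> (\<exists>C. circuit E indep C \<and> C \<subseteq> X \<and> x \<in> C \<and> y \<in> C))"
  unfolding connected_matroid_def by (simp add: circuit_restrict)

text \<open>Every element of the closure lies on a circuit that meets \<open>C\<close>, and such
  circuits can be joined through \<open>C\<close>. Loops must be excluded: they belong to every
  closure but share a circuit with nothing else.\<close>

lemma connected_cl_circuit:
  assumes C: "circuit E indep C" and noloop: "\<And>x. x \<in> cl C - C \<Longrightarrow> indep {x}"
  shows "connected_matroid (cl C) (restrict_indep indep (cl C))"
proof -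
  note CE = circuit_subset[OF C]
  have meets: "\<exists>D. circuit E indep D \<and> D \<subseteq> cl C \<and> x \<in> D \<and> D \<inter> C \<noteq> {}" if x: "x \<in> cl C" for x
  proof (cases "x \<in> C")
    case True
    then show ?thesis using C subset_cl[OF CE] by blast
  next
    case False
    obtain D where D: "circuit E indep D" "x \<in> D" "D \<subseteq> insert x C"
      using x False CE by (rule cl_imp_circuit)
    have "D \<inter> C \<noteq> {}"
      using circuit_not_indep[OF D(1), of "{x}"] noloop[of x] x False D(3) by auto
    then show ?thesis using D subset_cl[OF CE] x by blast
  qed
  show ?thesis
  proof (rule iffD2[OF connected_restrict_iff[OF cl_subset_ground]], intro ballI impI)
    fix x y assume xy: "x \<in> cl C" "y \<in> cl C"
    obtain D where D: "circuit E indep D" "D \<subseteq> cl C" "x \<in> D" "D \<inter> C \<noteq> {}"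
      using meets[OF xy(1)] by auto
    obtain D' where D': "circuit E indep D'" "D' \<subseteq> cl C" "y \<in> D'" "D' \<inter> C \<noteq> {}"
      using meets[OF xy(2)] by auto
    obtain z where z: "z \<in> D'" "z \<in> C" using D'(4) by auto
    obtain C1 where C1: "circuit E indep C1" "x \<in> C1" "z \<in> C1" "C1 \<subseteq> D \<union> C"
      using circuits_meet_imp_common_circuit[OF D(1) C D(3) z(2) D(4)] by auto
    obtain C2 where "circuit E indep C2" "x \<in> C2" "y \<in> C2" "C2 \<subseteq> C1 \<union> D'"
      using circuits_meet_imp_common_circuit[OF C1(1) D'(1) C1(2) D'(3)] z C1 by blast
    then show "\<exists>C'. circuit E indep C' \<and> C' \<subseteq> cl C \<and> x \<in> C' \<and> y \<in> C'"
      using C1(4) D(2) D'(2) subset_cl[OF CE] by blast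
  qed
qed

text \<open>The second element matters, since a single loop forms a connected matroid by
  convention.\<close>

lemma connected_imp_loopless:
  assumes conn: "connected_matroid E indep" and xy: "x \<in> E" "y \<in> E" "x \<noteq> y"
  shows "indep {x}"
proof -
  obtain C where "circuit E indep C" "x \<in> C" "y \<in> C"
    using conn xy unfolding connected_matroid_def by blast
  then show ?thesis using xy(3) by (auto simp: circuit_def)
qed

text \<open>The union of bases of the two parts is too large to be independent, and a circuit inside
  it cannot lie in either basis.\<close>

lemma circuit_meets_both_if_rank_less:
  assumes X: "A \<union> B \<subseteq> E" "A \<inter> B = {}"
    and less: "rank indep (A \<union> B) < rank indep A + rank indep B"
  obtains C where "circuit E indep C" "C \<subseteq> A \<union> B" "C \<inter> A \<noteq> {}" "C \<inter> B \<noteq> {}"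
proof -
  obtain I where I: "I \<subseteq> A" "indep I" "card I = rank indep A" by (rule rank_witness)
  obtain J where J: "J \<subseteq> B" "indep J" "card J = rank indep B" by (rule rank_witness)
  have "card (I \<union> J) = card I + card J"
    using I J X(2) indep_finite by (intro card_Un_disjoint) auto
  then have "\<not> indep (I \<union> J)" using less I J card_le_rank[of "I \<union> J" "A \<union> B"] by auto
  moreover have "I \<union> J \<subseteq> E" using I(1) J(1) X(1) by auto
  ultimately obtain C where C: "C \<subseteq> I \<union> J" "circuit E indep C"
    using dependent_contains_circuit by blast
  have "\<not> C \<subseteq> I" "\<not> C \<subseteq> J"
    using circuit_not_indep[OF C(2)] I(2) J(2) by auto
  then show ?thesis using that[OF C(2)] C(1) I(1) J(1) by blast
qed

text \<open>A matroid is determined by the ranks of its nontrivial connected flats, \<open>E\<close>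
  among them when it is dependent. This is why a list of these flats with their ranks, as in (iii)
  and (iv), can pin the matroid down.\<close>

lemma indep_iff_connected_flats:
  assumes conn: "connected_matroid E indep"
  shows "indep I \<longleftrightarrow> I \<subseteq> E \<and>
    (\<forall>X. connected_flat E indep X \<and> nontrivial indep X \<longrightarrow> card (I \<inter> X) \<le> rank indep X)"
    (is "_ \<longleftrightarrow> ?R")
proof
  assume "indep I"
  then show ?R
    using indep_subset_ground by (auto intro!: card_le_rank intro: indep_mono)
next
  assume R: ?R
  show "indep I"
  proof (rule ccontr)
    assume "\<not> indep I"
    then obtain C where C: "C \<subseteq> I" "circuit E indep C"
      using R dependent_contains_circuit by blast
    note CE = circuit_subset[OF C(2)]
    have "indep {x}" if x: "x \<in> cl C - C" for x
    proof -
      obtain y where "y \<in> C" using circuit_nonempty[OF C(2)] by auto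
      then show ?thesis
        using connected_imp_loopless[OF conn, of x y] x CE cl_subset_ground[of C] by blast
    qed
    then have "connected_flat E indep (cl C)"
      unfolding connected_flat_def using flat_cl[OF CE] connected_cl_circuit[OF C(2)] by auto
    moreover have "nontrivial indep (cl C)"
      unfolding nontrivial_def using circuit_not_indep[OF C(2)] subset_cl[OF CE] by auto
    ultimately have "card (I \<inter> cl C) \<le> rank indep C" using R rank_cl[OF CE] by auto
    moreover have "card C \<le> card (I \<inter> cl C)"
      using C(1) subset_cl[OF CE] cl_subset_ground[of C] finite_ground
      by (intro card_mono) (auto intro: finite_subset)
    ultimately show False using circuit_rank[OF C(2)] by simp
  qed
qed

end

section \<open>Lattice paths as height functions\<close>

text \<open>Heights are functions of the number of steps and not of the column, so that the steps of
  a path correspond to the elements of the matroid. Two paths are thereby compared along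
  antidiagonals.\<close>

definition unit_steps :: "nat \<Rightarrow> (nat \<Rightarrow> nat) \<Rightarrow> bool" where
  "unit_steps n g \<longleftrightarrow> g 0 = 0 \<and> (\<forall>k<n. g k \<le> g (Suc k) \<and> g (Suc k) \<le> Suc (g k))"

lemma unit_steps_step:
  "unit_steps n g \<Longrightarrow> k < n \<Longrightarrow> g k \<le> g (Suc k) \<and> g (Suc k) \<le> Suc (g k)"
  by (simp add: unit_steps_def)

lemma unit_steps_0: "unit_steps n g \<Longrightarrow> g 0 = 0"
  by (simp add: unit_steps_def)

lemma unit_steps_bounds:
  assumes g: "unit_steps n g" and "a \<le> b" "b \<le> n"
  shows "g a \<le> g b \<and> g b \<le> g a + (b - a)"
  using assms(2,3)
proof (induction b rule: dec_induct)
  case (step k)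
  then show ?case using unit_steps_step[OF g, of k] by auto
qed simp

lemma unit_steps_mono: "unit_steps n g \<Longrightarrow> a \<le> b \<Longrightarrow> b \<le> n \<Longrightarrow> g a \<le> g b"
  using unit_steps_bounds by blast

lemma unit_steps_le: "unit_steps n g \<Longrightarrow> k \<le> n \<Longrightarrow> g k \<le> k"
  using unit_steps_bounds[of n g 0 k] by (simp add: unit_steps_0)

lemma unit_steps_intermediate_value:
  assumes g: "unit_steps n g" and "a \<le> b" "b \<le> n" "g a \<le> y" "y \<le> g b"
  shows "\<exists>k. a \<le> k \<and> k \<le> b \<and> g k = y"
  using assms(2-)
proof (induction b rule: dec_induct)
  case base
  then show ?case by auto
next
  case (step k)
  show ?case
  proof (cases "y \<le> g k")
    case True
    then show ?thesis using step by fastforce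
  next
    case False
    then have "g (Suc k) = y" using step.prems unit_steps_step[OF g, of k] by auto
    then show ?thesis using step by (intro exI[of _ "Suc k"]) auto
  qed
qed

text \<open>Stated for a stretch \<open>a..b\<close> instead of \<open>unit_steps\<close>, because
  the path used for the rank of a segment starts at a height other than 0.\<close>

lemma card_up_steps:
  assumes g: "\<And>k. a \<le> k \<Longrightarrow> k < b \<Longrightarrow> g k \<le> g (Suc k) \<and> g (Suc k) \<le> Suc (g k)" and "a \<le> b"
  shows "g a \<le> g b \<and> card {k. a < k \<and> k \<le> b \<and> g (k - 1) < g k} = g b - (g a :: nat)"
  using assms(2) g
proof (induction b rule: dec_induct)
  case base
  then show ?case by (simp add: card_eq_0_iff)
next
  case (step b)
  let ?S = "\<lambda>b. {k. a < k \<and> k \<le> b \<and> g (k - 1) < g k}"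
  have IH: "g a \<le> g b \<and> card (?S b) = g b - g a" using step by auto
  have fin: "finite (?S b)" by (rule finite_subset[of _ "{..b}"]) auto
  have "?S (Suc b) = (if g b < g (Suc b) then insert (Suc b) (?S b) else ?S b)"
    using step.hyps by (auto simp: le_Suc_eq)
  then have "card (?S (Suc b)) = (if g b < g (Suc b) then Suc (card (?S b)) else card (?S b))"
    using fin by simp
  moreover have "g b \<le> g (Suc b)" "g (Suc b) \<le> Suc (g b)" using step by auto
  ultimately show ?case using IH by (simp split: if_splits)
qed

section \<open>Heights and relative position of lattice paths\<close>

definition north_count :: "step list \<Rightarrow> nat \<Rightarrow> nat" where
  "north_count P k = count_list (take k P) North"

lemma count_East_North: "count_list xs East + count_list xs North = length xs"
proof (induction xs)
  case (Cons s xs)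
  then show ?case by (cases s) auto
qed simp

lemma length_lattice_path: "lattice_path m r P \<Longrightarrow> length P = m + r"
  using count_East_North[of P] by (simp add: lattice_path_def)

lemma north_count_end: "lattice_path m r P \<Longrightarrow> north_count P (m + r) = r"
  using length_lattice_path[of m r P] by (simp add: north_count_def lattice_path_def)

lemma north_count_Suc:
  "k < length P \<Longrightarrow> north_count P (Suc k) = north_count P k + (if P ! k = North then 1 else 0)"
  by (auto simp: north_count_def take_Suc_conv_app_nth)

lemma unit_steps_north_count: "unit_steps (length P) (north_count P)"
  by (auto simp: unit_steps_def north_count_Suc) (simp add: north_count_def)

lemma count_East_take: "k \<le> length P \<Longrightarrow> count_list (take k P) East = k - north_count P k"
  using count_East_North[of "take k P"] by (simp add: north_count_def)

text \<open>Makes the intermediate value lemma applicable to columns: a path visits every column up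
  to the one it ends in.\<close>

lemma unit_steps_east_count:
  assumes "unit_steps n g" shows "unit_steps n (\<lambda>k. k - g k)"
  using assms unit_steps_le[OF assms]
  by (auto simp: unit_steps_def)

lemma path_points_eq:
  "path_points P = {(k - north_count P k, north_count P k) | k. k \<le> length P}"
  unfolding path_points_def by (metis (no_types, lifting) count_East_take north_count_def)

text \<open>Translates the comparison on vertical lines into one on antidiagonals. Among points of
  one column, height grows with the step number, so it only has to be decided which path reaches the
  column first.\<close>

lemma goes_above_iff:
  assumes P: "lattice_path m r P" and Q: "lattice_path m r Q"
  shows "goes_above P Q \<longleftrightarrow> (\<exists>k\<le>m + r. north_count Q k < north_count P k)"
proof -
  let ?p = "north_count P" and ?q = "north_count Q"
  have lP: "length P = m + r" and lQ: "length Q = m + r"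
    using P Q by (auto dest: length_lattice_path)
  have p: "unit_steps (m + r) ?p" and q: "unit_steps (m + r) ?q"
    using unit_steps_north_count[of P] unit_steps_north_count[of Q] lP lQ by simp_all
  note e = unit_steps_east_count[OF q]
  show ?thesis
  proof
    assume "goes_above P Q"
    then obtain k where k: "k \<le> m + r"
      and above: "\<And>k'. k' \<le> m + r \<Longrightarrow> k - ?p k = k' - ?q k' \<Longrightarrow> ?q k' < ?p k"
      by (auto simp: goes_above_def path_points_eq lP lQ)
    show "\<exists>k\<le>m + r. ?q k < ?p k"
    proof (rule ccontr)
      assume "\<not> ?thesis"
      then have le: "?p k \<le> ?q k" using k by auto
      have "k - ?p k \<le> m + r - ?p (m + r)"
        using unit_steps_mono[OF unit_steps_east_count[OF p] k] by simp
      then have "\<exists>k'. k \<le> k' \<and> k' \<le> m + r \<and> k' - ?q k' = k - ?p k"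
        using le k by (intro unit_steps_intermediate_value[OF e])
          (auto simp: north_count_end[OF P] north_count_end[OF Q])
      then obtain k' where k': "k \<le> k'" "k' \<le> m + r" "k' - ?q k' = k - ?p k" by blast
      then have "?q k' < ?p k" using above[of k'] by simp
      then show False using k' unit_steps_le[OF q, of k'] unit_steps_le[OF p, of k] k by arith
    qed
  next
    assume "\<exists>k\<le>m + r. ?q k < ?p k"
    then obtain k where k: "k \<le> m + r" "?q k < ?p k" by auto
    have "?q k' < ?p k" if k': "k' \<le> m + r" "k - ?p k = k' - ?q k'" for k'
    proof (rule ccontr)
      assume "\<not> ?thesis"
      then have "k \<le> k'" using k'(2) unit_steps_le[OF q k'(1)] unit_steps_le[OF p k(1)] by arith
      then have "k - ?q k \<le> k' - ?q k'" using unit_steps_mono[OF e] k'(1) by auto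
      then show False using k'(2) k unit_steps_le[OF p k(1)] by arith
    qed
    then show "goes_above P Q"
      unfolding goes_above_def path_points_eq lP lQ using k(1) by blast
  qed
qed

text \<open>The mirror image: a path \<open>Q\<close> that is not higher after \<open>k\<close>
  steps has visited the column by then, so the witness is sought before \<open>k\<close>.\<close>

lemma goes_below_iff:
  assumes P: "lattice_path m r P" and Q: "lattice_path m r Q"
  shows "goes_below P Q \<longleftrightarrow> (\<exists>k\<le>m + r. north_count P k < north_count Q k)"
proof -
  let ?p = "north_count P" and ?q = "north_count Q"
  have lP: "length P = m + r" and lQ: "length Q = m + r"
    using P Q by (auto dest: length_lattice_path)
  have p: "unit_steps (m + r) ?p" and q: "unit_steps (m + r) ?q"
    using unit_steps_north_count[of P] unit_steps_north_count[of Q] lP lQ by simp_all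
  note e = unit_steps_east_count[OF q]
  show ?thesis
  proof
    assume "goes_below P Q"
    then obtain k where k: "k \<le> m + r"
      and below: "\<And>k'. k' \<le> m + r \<Longrightarrow> k - ?p k = k' - ?q k' \<Longrightarrow> ?p k < ?q k'"
      by (auto simp: goes_below_def path_points_eq lP lQ)
    show "\<exists>k\<le>m + r. ?p k < ?q k"
    proof (rule ccontr)
      assume "\<not> ?thesis"
      then have le: "?q k \<le> ?p k" using k by auto
      have "\<exists>k'. 0 \<le> k' \<and> k' \<le> k \<and> k' - ?q k' = k - ?p k"
        using le k by (intro unit_steps_intermediate_value[OF e]) auto
      then obtain k' where k': "k' \<le> k" "k' - ?q k' = k - ?p k" by blast
      then have "?p k < ?q k'" using below[of k'] k by simp
      then show False
        using k' unit_steps_le[OF q, of k'] unit_steps_le[OF p, of k] k by arith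
    qed
  next
    assume "\<exists>k\<le>m + r. ?p k < ?q k"
    then obtain k where k: "k \<le> m + r" "?p k < ?q k" by auto
    have "?p k < ?q k'" if k': "k' \<le> m + r" "k - ?p k = k' - ?q k'" for k'
    proof (rule ccontr)
      assume "\<not> ?thesis"
      then have "k' \<le> k" using k'(2) unit_steps_le[OF q k'(1)] unit_steps_le[OF p k(1)] by arith
      then have "k' - ?q k' \<le> k - ?q k" using unit_steps_mono[OF e] k(1) by auto
      then show False using k'(2) k unit_steps_le[OF q k(1)] by arith
    qed
    then show "goes_below P Q"
      unfolding goes_below_def path_points_eq lP lQ using k(1) by blast
  qed
qed

lemma mem_paths_between_iff:
  assumes "lattice_path m r P" "lattice_path m r Q"
  shows "R \<in> paths_between m r P Q \<longleftrightarrow> lattice_path m r R \<and>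
    (\<forall>k\<le>m + r. north_count P k \<le> north_count R k \<and> north_count R k \<le> north_count Q k)"
proof (cases "lattice_path m r R")
  case True
  show ?thesis
    unfolding paths_between_def mem_Collect_eq goes_above_iff[OF True assms(2)]
      goes_below_iff[OF True assms(1)]
    using True by (meson not_less)
qed (simp add: paths_between_def)

definition path_of :: "nat \<Rightarrow> (nat \<Rightarrow> nat) \<Rightarrow> step list" where
  "path_of n g = map (\<lambda>k. if g k < g (Suc k) then North else East) [0..<n]"

lemma north_count_path_of:
  assumes g: "unit_steps n g" shows "k \<le> n \<Longrightarrow> north_count (path_of n g) k = g k"
proof (induction k)
  case 0
  then show ?case by (simp add: north_count_def unit_steps_0[OF g])
next
  case (Suc k)
  have "north_count (path_of n g) (Suc k) = g k + (if g k < g (Suc k) then 1 else 0)"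
    using Suc by (subst north_count_Suc) (auto simp: path_of_def)
  then show ?case using unit_steps_step[OF g, of k] Suc.prems by auto
qed

lemma lattice_path_path_of:
  assumes g: "unit_steps n g" shows "lattice_path (n - g n) (g n) (path_of n g)"
proof -
  have len: "length (path_of n g) = n" by (simp add: path_of_def)
  have "count_list (path_of n g) North = g n"
    using north_count_path_of[OF g order.refl] len by (simp add: north_count_def)
  then show ?thesis
    using count_East_North[of "path_of n g"] len by (auto simp: lattice_path_def)
qed

section \<open>Partial transversals and greedy paths\<close>

lemma ith_north_step_iff:
  "ith_north_step R i j \<longleftrightarrow>
    1 \<le> j \<and> j \<le> length R \<and> north_count R (j - 1) < i \<and> i = north_count R j"
proof -
  have "R ! (j - 1) = North \<longleftrightarrow> north_count R (j - 1) < north_count R j" if "1 \<le> j" "j \<le> length R"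
    using north_count_Suc[of "j - 1" R] that by auto
  then show ?thesis by (auto simp: ith_north_step_def north_count_def)
qed

text \<open>The lowest path above \<open>P\<close> having North steps at all positions in \<open>I\<close>.\<close>

fun greedy_height :: "(nat \<Rightarrow> nat) \<Rightarrow> nat set \<Rightarrow> nat \<Rightarrow> nat" where
  "greedy_height p I 0 = 0"
| "greedy_height p I (Suc k) =
    (if Suc k \<in> I then Suc (greedy_height p I k) else max (greedy_height p I k) (p (Suc k)))"

text \<open>The witness \<open>a\<close> is the last position at which \<open>p\<close> pushed the
  path up; after it the path climbs only at elements of \<open>I\<close>. By this formula the
  inequalities imposed on \<open>I\<close> keep the path below the upper boundary.\<close>

lemma greedy_height:
  assumes p: "unit_steps n p" and k: "k \<le> n"
  shows "p k \<le> greedy_height p I k \<and>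
    (\<exists>a\<le>k. greedy_height p I k = card (I \<inter> {a<..k}) + p a)"
  using k
proof (induction k)
  case 0
  then show ?case by (simp add: unit_steps_0[OF p])
next
  case (Suc k)
  then obtain a where a: "a \<le> k" "greedy_height p I k = card (I \<inter> {a<..k}) + p a" by auto
  have ge: "p k \<le> greedy_height p I k" using Suc by simp
  have split: "{a<..Suc k} = insert (Suc k) {a<..k}" using a(1) by auto
  show ?case
  proof (cases "Suc k \<in> I")
    case True
    then have "greedy_height p I (Suc k) = card (I \<inter> {a<..Suc k}) + p a"
      using a(2) by (simp add: split)
    moreover have "p (Suc k) \<le> greedy_height p I (Suc k)"
      using True ge unit_steps_step[OF p, of k] Suc.prems by simp
    ultimately show ?thesis using a(1) le_SucI by blast
  next
    case False
    show ?thesis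
    proof (cases "p (Suc k) \<le> greedy_height p I k")
      case True
      then have "greedy_height p I (Suc k) = card (I \<inter> {a<..Suc k}) + p a"
        using a(2) False by (simp add: split max_absorb1)
      then show ?thesis using False a(1) le_SucI by (metis greedy_height.simps(2) max.cobounded2)
    next
      case 2: False
      \<comment> \<open>The boundary lifts the path here, so the count starts afresh with
        \<open>a = Suc k\<close>.\<close>
      then have "greedy_height p I (Suc k) = card (I \<inter> {Suc k<..Suc k}) + p (Suc k)"
        using False by simp
      then show ?thesis by (metis le_add2 order.refl)
    qed
  qed
qed

lemma unit_steps_greedy_height:
  assumes p: "unit_steps n p" shows "unit_steps n (greedy_height p I)"
proof -
  have "p (Suc k) \<le> Suc (greedy_height p I k)" if "k < n" for k
    using greedy_height[OF p, of k I] unit_steps_step[OF p, of k] that by auto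
  then show ?thesis by (auto simp: unit_steps_def)
qed

text \<open>In a matching, \<open>x\<close> can only get an index \<open>i\<close> with
  \<open>p (x - 1) < i \<le> q x\<close>, for the heights \<open>p\<close>, \<open>q\<close> of
  \<open>P\<close>, \<open>Q\<close>. So elements at positions \<open>a + 1..b\<close> use distinct
  indices in \<open>p a + 1..q b\<close>. Conversely the greedy path alone matches all of
  \<open>I\<close>: each \<open>x\<close> gets the height reached at \<open>x\<close>.\<close>

lemma lpm_indep_iff:
  assumes P: "lattice_path m r P" and Q: "lattice_path m r Q" and above: "\<not> goes_above P Q"
  shows "lpm_indep m r P Q I \<longleftrightarrow> I \<subseteq> {1..m + r} \<and>
    (\<forall>a b. a \<le> b \<and> b \<le> m + r \<longrightarrow> card (I \<inter> {a<..b}) + north_count P a \<le> north_count Q b)"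
    (is "_ \<longleftrightarrow> _ \<and> ?R")
proof -
  let ?p = "north_count P" and ?q = "north_count Q"
  have p: "unit_steps (m + r) ?p" and q: "unit_steps (m + r) ?q"
    using unit_steps_north_count[of P] unit_steps_north_count[of Q]
      length_lattice_path[OF P] length_lattice_path[OF Q] by simp_all
  have pq: "?p k \<le> ?q k" if "k \<le> m + r" for k
    using above that by (auto simp: goes_above_iff[OF P Q] not_less)
  show ?thesis
  proof
    assume "lpm_indep m r P Q I"
    then obtain f where f: "inj_on f I" "\<forall>x\<in>I. x \<in> north_set m r P Q (f x)" and I: "I \<subseteq> {1..m + r}"
      by (auto simp: lpm_indep_def transversal_indep_def)
    have range: "?p (x - 1) < f x \<and> f x \<le> ?q x" if x: "x \<in> I" for x
    proof -
      obtain R where R: "R \<in> paths_between m r P Q" "ith_north_step R (f x) x"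
        using f(2) x by (auto simp: north_set_def)
      have "x \<le> m + r" using I x by auto
      then have "?p (x - 1) \<le> north_count R (x - 1)" "north_count R x \<le> ?q x"
        using R(1) by (auto simp: mem_paths_between_iff[OF P Q])
      then show ?thesis using R(2) by (auto simp: ith_north_step_iff)
    qed
    have "card (I \<inter> {a<..b}) + ?p a \<le> ?q b" if ab: "a \<le> b" "b \<le> m + r" for a b
    proof -
      have "f x \<in> {?p a<..?q b}" if x: "x \<in> I" "a < x" "x \<le> b" for x
      proof -
        have "?p a \<le> ?p (x - 1)" "?q x \<le> ?q b"
          using unit_steps_mono[OF p, of a "x - 1"] unit_steps_mono[OF q, of x b] x ab by linarith+
        then show ?thesis using range[OF x(1)] by auto
      qed
      then have "card (f ` (I \<inter> {a<..b})) \<le> card {?p a<..?q b}"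
        by (intro card_mono) auto
      moreover have "card (f ` (I \<inter> {a<..b})) = card (I \<inter> {a<..b})"
        by (rule card_image) (rule inj_on_subset[OF f(1)], auto)
      moreover have "?p a \<le> ?q b" using pq[of a] unit_steps_mono[OF q ab] ab by auto
      ultimately show ?thesis by simp
    qed
    then show "I \<subseteq> {1..m + r} \<and> ?R" using I by blast
  next
    assume IR: "I \<subseteq> {1..m + r} \<and> ?R"
    define g where "g = greedy_height ?p I"
    have g: "unit_steps (m + r) g" unfolding g_def by (rule unit_steps_greedy_height[OF p])
    have between: "?p k \<le> g k \<and> g k \<le> ?q k" if "k \<le> m + r" for k
      using greedy_height[OF p that, of I] IR that unfolding g_def by metis
    have "g (m + r) = r"
      using between[of "m + r"] by (simp add: north_count_end[OF P] north_count_end[OF Q])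
    define R where "R = path_of (m + r) g"
    have lR: "lattice_path m r R"
      using lattice_path_path_of[OF g] \<open>g (m + r) = r\<close> by (simp add: R_def)
    have Rg: "north_count R k = g k" if "k \<le> m + r" for k
      unfolding R_def by (rule north_count_path_of[OF g that])
    have R: "R \<in> paths_between m r P Q"
      unfolding mem_paths_between_iff[OF P Q] using lR Rg between by auto
    have step: "g (x - 1) < g x \<and> 1 \<le> x \<and> x \<le> m + r" if "x \<in> I" for x
      using IR that by (cases x) (auto simp: g_def)
    have "inj_on g I"
    proof (rule linorder_inj_onI)
      fix x y assume xy: "x < y" "x \<in> I" "y \<in> I"
      then have "g x \<le> g (y - 1)" using step[of y] by (intro unit_steps_mono[OF g]) auto
      then show "g x \<noteq> g y" using step[of y] xy by auto
    qed auto
    moreover have "g ` I \<subseteq> {1..r}"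
    proof
      fix i assume "i \<in> g ` I"
      then obtain x where x: "x \<in> I" "i = g x" by auto
      then show "i \<in> {1..r}"
        using step[of x] unit_steps_mono[OF g, of x "m + r"] \<open>g (m + r) = r\<close> by auto
    qed
    moreover have "x \<in> north_set m r P Q (g x)" if "x \<in> I" for x
    proof -
      have "ith_north_step R (g x) x"
        unfolding ith_north_step_iff
        using step[OF that] Rg[of x] Rg[of "x - 1"] length_lattice_path[OF lR]
        by (metis diff_le_self le_trans)
      then show ?thesis using R by (auto simp: north_set_def)
    qed
    ultimately show "lpm_indep m r P Q I"
      unfolding lpm_indep_def transversal_indep_def using IR by blast
  qed
qed

text \<open>The elements at positions \<open>a + 1, \<dots>, b\<close> carry at most \<open>q b - p a\<close> elements of a basis,
  because a path between \<open>p\<close> and \<open>q\<close> cannot climb further there.\<close>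

locale interval_matroid = matroid E indep for E :: "'a set" and indep +
  fixes pos :: "'a \<Rightarrow> nat" and n :: nat and p q :: "nat \<Rightarrow> nat"
  assumes pos_bij: "bij_betw pos E {1..n}"
    and p_steps: "unit_steps n p"
    and q_steps: "unit_steps n q"
    and ends_meet: "p n = q n"
    and indep_iff: "indep I \<longleftrightarrow> I \<subseteq> E \<and>
      (\<forall>a b. a \<le> b \<and> b \<le> n \<longrightarrow> card {x \<in> I. a < pos x \<and> pos x \<le> b} + p a \<le> q b)"

lemma lattice_path_matroid_iff:
  assumes "matroid E indep"
  shows "lattice_path_matroid E indep \<longleftrightarrow> (\<exists>pos n p q. interval_matroid E indep pos n p q)"
proof
  assume "lattice_path_matroid E indep"
  then obtain m r P Q f where P: "lattice_path m r P" and Q: "lattice_path m r Q"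
    and above: "\<not> goes_above P Q" and f: "bij_betw f E {1..m + r}"
    and iso: "\<And>X. X \<subseteq> E \<Longrightarrow> indep X \<longleftrightarrow> lpm_indep m r P Q (f ` X)"
    unfolding lattice_path_matroid_def matroid_iso_def by blast
  interpret matroid E indep by fact
  have "interval_matroid E indep f (m + r) (north_count P) (north_count Q)"
  proof unfold_locales
    show "unit_steps (m + r) (north_count P)" "unit_steps (m + r) (north_count Q)"
      using unit_steps_north_count[of P] unit_steps_north_count[of Q]
        length_lattice_path[OF P] length_lattice_path[OF Q] by simp_all
    show "north_count P (m + r) = north_count Q (m + r)"
      by (simp add: north_count_end[OF P] north_count_end[OF Q])
    fix I
    have "card (f ` I \<inter> {a<..b}) = card {x \<in> I. a < f x \<and> f x \<le> b}" if "I \<subseteq> E" for a b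
    proof -
      have "f ` I \<inter> {a<..b} = f ` {x \<in> I. a < f x \<and> f x \<le> b}" by auto
      moreover have "inj_on f {x \<in> I. a < f x \<and> f x \<le> b}"
        using bij_betw_imp_inj_on[OF f] by (rule inj_on_subset) (use that in auto)
      ultimately show ?thesis by (simp add: card_image)
    qed
    moreover have "f ` I \<subseteq> {1..m + r}" if "I \<subseteq> E"
      using that bij_betw_imp_surj_on[OF f] by blast
    ultimately show "indep I \<longleftrightarrow> I \<subseteq> E \<and>
      (\<forall>a b. a \<le> b \<and> b \<le> m + r \<longrightarrow>
        card {x \<in> I. a < f x \<and> f x \<le> b} + north_count P a \<le> north_count Q b)"
      using iso[of I] indep_subset_ground[of I] lpm_indep_iff[OF P Q above, of "f ` I"] by auto
  qed (rule f)
  then show "\<exists>pos n p q. interval_matroid E indep pos n p q" by blast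
next
  assume "\<exists>pos n p q. interval_matroid E indep pos n p q"
  then obtain pos n p q where "interval_matroid E indep pos n p q" by blast
  then interpret interval_matroid E indep pos n p q .
  let ?P = "path_of n p" and ?Q = "path_of n q"
  \<comment> \<open>The region has width \<open>n - p n\<close>; as \<open>p n \<le> n\<close>, the
    difference does not truncate.\<close>
  have n: "n - p n + p n = n" using unit_steps_le[OF p_steps, of n] by simp
  have P: "lattice_path (n - p n) (p n) ?P" and Q: "lattice_path (n - p n) (p n) ?Q"
    using lattice_path_path_of[OF p_steps] lattice_path_path_of[OF q_steps] ends_meet by simp_all
  note cP = north_count_path_of[OF p_steps] and cQ = north_count_path_of[OF q_steps]
  \<comment> \<open>The inequality for the empty set with \<open>a = b = k\<close>.\<close>
  have "p k \<le> q k" if "k \<le> n" for k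
    using indep_iff[of "{}"] indep_empty that by auto
  then have above: "\<not> goes_above ?P ?Q"
    by (auto simp: goes_above_iff[OF P Q] n cP cQ not_less)
  have "matroid_iso E indep {1..n - p n + p n} (lpm_indep (n - p n) (p n) ?P ?Q)"
    unfolding matroid_iso_def
  proof (intro exI[of _ pos] conjI allI impI)
    show "bij_betw pos E {1..n - p n + p n}" using pos_bij by (simp only: n)
    fix X assume X: "X \<subseteq> E"
    have "card (pos ` X \<inter> {a<..b}) = card {x \<in> X. a < pos x \<and> pos x \<le> b}" for a b
    proof -
      have "pos ` X \<inter> {a<..b} = pos ` {x \<in> X. a < pos x \<and> pos x \<le> b}" by auto
      moreover have "inj_on pos {x \<in> X. a < pos x \<and> pos x \<le> b}"
        using bij_betw_imp_inj_on[OF pos_bij] by (rule inj_on_subset) (use X in auto)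
      ultimately show ?thesis by (simp add: card_image)
    qed
    moreover have "pos ` X \<subseteq> {1..n}" using X bij_betw_imp_surj_on[OF pos_bij] by blast
    ultimately show "indep X \<longleftrightarrow> lpm_indep (n - p n) (p n) ?P ?Q (pos ` X)"
      unfolding lpm_indep_iff[OF P Q above] n indep_iff using X cP cQ by auto
  qed
  then show "lattice_path_matroid E indep"
    unfolding lattice_path_matroid_def using P Q above by blast
qed

section \<open>Chains of flats determine lattice paths\<close>

text \<open>The proper members of the chain have a largest one as their union, so some element
  \<open>e\<close> lies in none of them. It takes the last position and the rest is ordered by
  induction.\<close>

lemma finite_chain_positions:
  assumes "finite E" "\<C> \<subseteq> Pow E" "\<And>A B. A \<in> \<C> \<Longrightarrow> B \<in> \<C> \<Longrightarrow> A \<subseteq> B \<or> B \<subseteq> A"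
  shows "\<exists>pos. bij_betw pos E {1..card E} \<and> (\<forall>A\<in>\<C>. A = {x \<in> E. pos x \<le> card A})"
  using assms
proof (induction "card E" arbitrary: E \<C>)
  case 0
  then have "E = {}" by simp
  then show ?case using 0 by (auto simp: bij_betw_def)
next
  case (Suc n)
  have "\<Union>(\<C> - {E}) \<noteq> E"
  proof (cases "\<C> - {E} = {}")
    case True
    then have "\<Union>(\<C> - {E}) = {}" by (simp only: Sup_empty)
    then show ?thesis using Suc.hyps(2) by (metis card.empty nat.distinct(1))
  next
    case False
    have "finite (\<C> - {E})"
      using Suc.prems(1,2) by (meson finite_Diff finite_Pow_iff finite_subset)
    then obtain M where M: "M \<in> \<C> - {E}" "\<And>A. A \<in> \<C> - {E} \<Longrightarrow> M \<subseteq> A \<Longrightarrow> M = A"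
      using finite_has_maximal[OF _ False] by auto
    then have "\<Union>(\<C> - {E}) = M" using Suc.prems(3) by blast
    then show ?thesis using M(1) by auto
  qed
  then obtain e where e: "e \<in> E" "e \<notin> \<Union>(\<C> - {E})" using Suc.prems(2) by blast
  have n: "n = card (E - {e})" using Suc.hyps(2) e(1) by simp
  have "\<exists>pos. bij_betw pos (E - {e}) {1..card (E - {e})} \<and>
      (\<forall>A\<in>\<C> - {E}. A = {x \<in> E - {e}. pos x \<le> card A})"
    by (rule Suc.hyps(1)[OF n]) (use Suc.prems e in auto)
  then obtain pos where pos: "bij_betw pos (E - {e}) {1..n}"
    "\<And>A. A \<in> \<C> - {E} \<Longrightarrow> A = {x \<in> E - {e}. pos x \<le> card A}"
    using n by auto
  define pos' where "pos' = pos(e := Suc n)"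
  have "bij_betw pos' (E - {e}) {1..n}"
    using pos(1) by (rule bij_betw_cong[THEN iffD1, rotated]) (auto simp: pos'_def)
  moreover have "bij_betw pos' {e} {Suc n}" by (simp add: pos'_def bij_betw_def)
  ultimately have "bij_betw pos' (E - {e} \<union> {e}) ({1..n} \<union> {Suc n})"
    by (rule bij_betw_combine) auto
  moreover have "E - {e} \<union> {e} = E" "{1..n} \<union> {Suc n} = {1..card E}"
    using e(1) Suc.hyps(2) by auto
  ultimately have bij: "bij_betw pos' E {1..card E}" by simp
  have "A = {x \<in> E. pos' x \<le> card A}" if A: "A \<in> \<C>" for A
  proof (cases "A = E")
    case True
    then show ?thesis using bij_betw_imp_surj_on[OF bij] by auto
  next
    case False
    have "card A \<le> n"
      unfolding n using A False e Suc.prems by (intro card_mono) auto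
    then have "{x \<in> E. pos' x \<le> card A} = {x \<in> E - {e}. pos x \<le> card A}"
      by (auto simp: pos'_def)
    then show ?thesis using pos(2)[of A] A False by simp
  qed
  then show ?case using bij by blast
qed

context matroid
begin

lemma rank_empty: "rank indep {} = 0"
  using rank_le_card[of "{}"] by simp

lemma rank_insert_le: "rank indep (insert e X) \<le> Suc (rank indep X)"
  using rank_submodular[of "{e}" X] rank_le_card[of "{e}"] by simp

text \<open>Members of \<open>\<F>\<close> become initial and members of \<open>\<G>\<close> final
  segments. For \<open>F = ini b\<close> and \<open>G = E - ini a\<close> the rank equation in
  \<open>flats\<close> reads \<open>rank indep X = q b - p a\<close>, so the interval inequality is
  exactly the rank bound at \<open>X\<close>. Flats in one of the chains correspond to
  \<open>a = 0\<close> or \<open>b = n\<close>.\<close>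

lemma chains_imp_interval_matroid:
  assumes conn: "connected_matroid E indep"
    and sub: "\<F> \<subseteq> Pow E" "\<G> \<subseteq> Pow E"
    and chainF: "\<And>A B. A \<in> \<F> \<Longrightarrow> B \<in> \<F> \<Longrightarrow> A \<subseteq> B \<or> B \<subseteq> A"
    and chainG: "\<And>A B. A \<in> \<G> \<Longrightarrow> B \<in> \<G> \<Longrightarrow> A \<subseteq> B \<or> B \<subseteq> A"
    and cross: "\<And>F G. F \<in> \<F> \<Longrightarrow> G \<in> \<G> \<Longrightarrow> F \<inter> G \<noteq> {} \<Longrightarrow> F \<union> G = E"
    and flats: "\<And>X. connected_flat E indep X \<Longrightarrow> nontrivial indep X \<Longrightarrow> X \<noteq> E \<Longrightarrow>
      X \<in> \<F> \<or> X \<in> \<G> \<or> (\<exists>F\<in>\<F>. \<exists>G\<in>\<G>. X = F \<inter> G \<and>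
        rank indep X + rank indep E = rank indep F + rank indep G)"
  shows "\<exists>pos n p q. interval_matroid E indep pos n p q"
proof -
  let ?r = "rank indep"
  let ?\<C> = "\<F> \<union> (\<lambda>G. E - G) ` \<G>"
  \<comment> \<open>Disjointness of \<open>F\<close> and \<open>G\<close> is the first alternative,
    \<open>F \<union> G = E\<close> the second.\<close>
  have cross': "F \<subseteq> E - G \<or> E - G \<subseteq> F" if "F \<in> \<F>" "G \<in> \<G>" for F G
    using cross[OF that] sub that by blast
  have chain: "A \<subseteq> B \<or> B \<subseteq> A" if "A \<in> ?\<C>" "B \<in> ?\<C>" for A B
    using that
  proof (elim UnE imageE)
    fix G G' assume "A = E - G" "G \<in> \<G>" "B = E - G'" "G' \<in> \<G>"
    then show ?thesis using chainG[of G G'] by blast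
  next
    fix G assume "A = E - G" "G \<in> \<G>" "B \<in> \<F>"
    then show ?thesis using cross'[of B G] by blast
  qed (use chainF cross' in blast)+
  have "?\<C> \<subseteq> Pow E" using sub by auto
  then have "\<exists>pos. bij_betw pos E {1..card E} \<and> (\<forall>A\<in>?\<C>. A = {x \<in> E. pos x \<le> card A})"
    by (rule finite_chain_positions[OF finite_ground _ chain])
  then obtain pos where positions: "bij_betw pos E {1..card E} \<and>
      (\<forall>A\<in>?\<C>. A = {x \<in> E. pos x \<le> card A})" by (rule exE)
  note bij = conjunct1[OF positions] and pos = bspec[OF conjunct2[OF positions]]
  let ?n = "card E"
  define ini where "ini k = {x \<in> E. pos x \<le> k}" for k
  define q where "q k = ?r (ini k)" for k
  define p where "p k = ?r E - ?r (E - ini k)" for k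
  have range: "0 < pos x \<and> pos x \<le> ?n" if "x \<in> E" for x
    using bij_betw_apply[OF bij that] by auto
  have ini_0: "ini 0 = {}" and ini_n: "ini ?n = E" using range by (auto simp: ini_def)
  have step: "\<exists>x\<in>E. ini (Suc k) = insert x (ini k) \<and> E - ini k = insert x (E - ini (Suc k))"
    if "k < ?n" for k
  proof -
    have "Suc k \<in> pos ` E" using that bij_betw_imp_surj_on[OF bij] by auto
    then obtain x where x: "x \<in> E" "pos x = Suc k" by auto
    then have "\<not> pos x \<le> k" by simp
    have "pos y = Suc k \<longleftrightarrow> y = x" if "y \<in> E" for y
      using bij_betw_imp_inj_on[OF bij] x that by (metis inj_onD)
    then have "ini (Suc k) = insert x (ini k) \<and> E - ini k = insert x (E - ini (Suc k))"
      using x(1) \<open>\<not> pos x \<le> k\<close> by (auto simp: ini_def le_Suc_eq)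
    then show ?thesis using x(1) by blast
  qed
  have rE: "?r (E - ini k) \<le> ?r E" for k by (rule rank_mono) auto
  have sub_r: "?r E \<le> q k + ?r (E - ini k)" for k
  proof -
    have "ini k \<union> (E - ini k) = E" by (auto simp: ini_def)
    then show ?thesis using rank_submodular[of "ini k" "E - ini k"] by (simp add: q_def)
  qed
  have indep_iff: "indep I \<longleftrightarrow> I \<subseteq> E \<and>
      (\<forall>a b. a \<le> b \<and> b \<le> ?n \<longrightarrow> card {x \<in> I. a < pos x \<and> pos x \<le> b} + p a \<le> q b)" for I
  proof
    assume I: "indep I"
    \<comment> \<open>Submodularity for \<open>ini b\<close> and \<open>E - ini a\<close>, whose
      union is \<open>E\<close>, bounds the rank of their intersection by
      \<open>q b + rank indep (E - ini a) - rank indep E\<close>, that is, by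
      \<open>q b - p a\<close>.\<close>
    have "card {x \<in> I. a < pos x \<and> pos x \<le> b} + p a \<le> q b" if ab: "a \<le> b" for a b
    proof -
      have "{x \<in> I. a < pos x \<and> pos x \<le> b} \<subseteq> ini b \<inter> (E - ini a)"
        using indep_subset_ground[OF I] by (auto simp: ini_def)
      then have "card {x \<in> I. a < pos x \<and> pos x \<le> b} \<le> ?r (ini b \<inter> (E - ini a))"
        by (rule card_le_rank) (rule indep_mono[OF I], auto)
      moreover have "ini b \<union> (E - ini a) = E" using ab by (auto simp: ini_def)
      ultimately show ?thesis
        using rank_submodular[of "ini b" "E - ini a"] rE[of a] by (simp add: p_def q_def)
    qed
    then show "I \<subseteq> E \<and>
      (\<forall>a b. a \<le> b \<and> b \<le> ?n \<longrightarrow> card {x \<in> I. a < pos x \<and> pos x \<le> b} + p a \<le> q b)"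
      using indep_subset_ground[OF I] by blast
  next
    assume I: "I \<subseteq> E \<and>
      (\<forall>a b. a \<le> b \<and> b \<le> ?n \<longrightarrow> card {x \<in> I. a < pos x \<and> pos x \<le> b} + p a \<le> q b)"
    have seg: "card (I \<inter> (ini b - ini a)) + p a \<le> q b" if "a \<le> b" "b \<le> ?n" for a b
    proof -
      have "I \<inter> (ini b - ini a) = {x \<in> I. a < pos x \<and> pos x \<le> b}"
        using I by (auto simp: ini_def)
      then show ?thesis using I that by auto
    qed
    have p0: "p 0 = 0" by (simp add: p_def ini_0)
    have qn: "q ?n = ?r E" by (simp add: q_def ini_n)
    have initial: "\<exists>b\<le>?n. F = ini b" if "F \<in> \<F>" for F
      using pos[of F] that sub(1) finite_ground
      by (intro exI[of _ "card F"]) (auto simp: ini_def intro: card_mono)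
    have final: "\<exists>a\<le>?n. G = E - ini a" if "G \<in> \<G>" for G
    proof -
      have "G = E - (E - G)" using sub(2) that by auto
      then show ?thesis using pos[of "E - G"] that sub(2) finite_ground
        by (intro exI[of _ "card (E - G)"]) (auto simp: ini_def intro!: card_mono)
    qed
    have "card (I \<inter> X) \<le> ?r X" if X: "connected_flat E indep X" "nontrivial indep X" for X
    proof (cases "X = E")
      case True
      then show ?thesis using seg[of 0 ?n] p0 qn by (simp add: ini_0 ini_n)
    next
      case False
      then consider "X \<in> \<F>" | "X \<in> \<G>"
        | F G where "F \<in> \<F>" "G \<in> \<G>" "X = F \<inter> G" "?r X + ?r E = ?r F + ?r G"
        using flats[OF X] by blast
      then show ?thesis
      proof cases
        case 1
        then obtain b where b: "b \<le> ?n" "X = ini b" using initial by blast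
        then show ?thesis using seg[of 0 b] p0 by (simp add: ini_0 q_def)
      next
        case 2
        then obtain a where a: "a \<le> ?n" "X = E - ini a" using final by blast
        then show ?thesis using seg[of a ?n] qn rE[of a] by (simp add: ini_n p_def)
      next
        case 3
        obtain b where b: "b \<le> ?n" "F = ini b" using initial[OF 3(1)] by blast
        obtain a where a: "a \<le> ?n" "G = E - ini a" using final[OF 3(2)] by blast
        have Xab: "X = ini b - ini a" using 3(3) a b by (auto simp: ini_def)
        moreover have "X \<noteq> {}" using X(2) indep_empty by (auto simp: nontrivial_def)
        ultimately have "a \<le> b" by (auto simp: ini_def)
        then show ?thesis
          using seg[of a b] b 3(4) rE[of a] a(2) Xab by (simp add: p_def q_def)
      qed
    qed
    then show "indep I" using I by (subst indep_iff_connected_flats[OF conn]) blast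
  qed
  have "interval_matroid E indep pos ?n p q"
  proof unfold_locales
    show "unit_steps ?n p"
    proof -
      have "p k \<le> p (Suc k) \<and> p (Suc k) \<le> Suc (p k)" if k: "k < ?n" for k
      proof -
        obtain x where x: "E - ini k = insert x (E - ini (Suc k))" using step[OF k] by auto
        then have "?r (E - ini k) \<le> Suc (?r (E - ini (Suc k)))"
          "?r (E - ini (Suc k)) \<le> ?r (E - ini k)"
          using rank_insert_le rank_insert_ge by metis+
        then show ?thesis using rE[of k] by (auto simp: p_def)
      qed
      then show ?thesis by (simp add: unit_steps_def p_def ini_0)
    qed
    show "unit_steps ?n q"
      using step rank_insert_le rank_insert_ge
      by (fastforce simp: unit_steps_def q_def ini_0 rank_empty)
    show "p ?n = q ?n" by (simp add: p_def q_def ini_n rank_empty)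
  qed (use bij indep_iff in auto)
  then show ?thesis by blast
qed

end

section \<open>Connected flats of lattice path matroids\<close>

context interval_matroid
begin

section \<open>Segments and their rank\<close>

text \<open>The bounds are cuts between elements, numbered \<open>0..n\<close> like the arguments of
  \<open>p\<close> and \<open>q\<close>; \<open>seg a s\<close> and \<open>seg s b\<close> are
  adjacent without overlap.\<close>

definition seg :: "nat \<Rightarrow> nat \<Rightarrow> 'a set" where
  "seg a b = {x \<in> E. a < pos x \<and> pos x \<le> b}"

lemma pos_range: "x \<in> E \<Longrightarrow> 0 < pos x \<and> pos x \<le> n"
  using bij_betw_apply[OF pos_bij, of x] by auto

lemma pos_inj: "x \<in> E \<Longrightarrow> y \<in> E \<Longrightarrow> pos x = pos y \<Longrightarrow> x = y"
  using bij_betw_imp_inj_on[OF pos_bij] by (auto dest: inj_onD)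

lemma pos_surj: assumes "0 < k" "k \<le> n" obtains x where "x \<in> E" "pos x = k"
proof -
  have "k \<in> pos ` E" using assms bij_betw_imp_surj_on[OF pos_bij] by auto
  then show ?thesis using that by blast
qed

lemma card_pos_Collect:
  assumes "\<And>k. P k \<Longrightarrow> 0 < k \<and> k \<le> n"
  shows "card {x \<in> E. P (pos x)} = card {k. P k}"
proof -
  have "pos ` {x \<in> E. P (pos x)} = {k. P k}"
    using assms pos_surj by (auto simp: image_iff) metis
  moreover have "inj_on pos {x \<in> E. P (pos x)}"
    using pos_inj by (auto simp: inj_on_def)
  ultimately show ?thesis by (metis card_image)
qed

lemma seg_subset: "seg a b \<subseteq> E"
  by (auto simp: seg_def)

lemma seg_mono: "a' \<le> a \<Longrightarrow> b \<le> b' \<Longrightarrow> seg a b \<subseteq> seg a' b'"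
  by (auto simp: seg_def)

lemma finite_seg: "finite (seg a b)"
  using finite_subset[OF seg_subset finite_ground] .

lemma seg_ground: "seg 0 n = E"
  using pos_range by (auto simp: seg_def)

lemma card_seg: "b \<le> n \<Longrightarrow> card (seg a b) = b - a"
proof -
  assume "b \<le> n"
  then have "card (seg a b) = card {k. a < k \<and> k \<le> b}"
    unfolding seg_def by (intro card_pos_Collect) auto
  also have "{k. a < k \<and> k \<le> b} = {a<..b}" by auto
  finally show ?thesis by simp
qed

lemma card_ground: "card E = n"
  using card_seg[of n 0] by (simp add: seg_ground)

lemma p_le_q: "k \<le> n \<Longrightarrow> p k \<le> q k"
  using indep_iff[of "{}"] indep_empty by auto

lemmas p_mono = unit_steps_mono[OF p_steps]
lemmas q_mono = unit_steps_mono[OF q_steps]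
lemmas p_bounds = unit_steps_bounds[OF p_steps]
lemmas q_bounds = unit_steps_bounds[OF q_steps]
lemmas q_step = unit_steps_step[OF q_steps]
lemmas p_0 = unit_steps_0[OF p_steps]
lemmas q_0 = unit_steps_0[OF q_steps]

lemma card_indep_seg:
  "indep I \<Longrightarrow> a \<le> b \<Longrightarrow> b \<le> n \<Longrightarrow> card (I \<inter> seg a b) + p a \<le> q b"
proof -
  assume I: "indep I" and ab: "a \<le> b" "b \<le> n"
  then have "I \<inter> seg a b = {x \<in> I. a < pos x \<and> pos x \<le> b}"
    using indep_subset_ground by (auto simp: seg_def)
  then show ?thesis using I ab indep_iff[of I] by auto
qed

text \<open>A basis of a segment consists of the North steps of the path that climbs from the lower
  boundary until it meets the upper one.\<close>

lemma rank_seg: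
  assumes ab: "a \<le> b" "b \<le> n"
  shows "rank indep (seg a b) = min (b - a) (q b - p a)"
proof (rule antisym)
  obtain I where I: "I \<subseteq> seg a b" "indep I" "card I = rank indep (seg a b)" by (rule rank_witness)
  have "I \<inter> seg a b = I" using I(1) by auto
  then have "card I \<le> q b - p a" using card_indep_seg[OF I(2) ab] by simp
  then show "rank indep (seg a b) \<le> min (b - a) (q b - p a)"
    using I(3) rank_le_card[OF finite_seg[of a b]] card_seg[of b a] ab by simp
next
  \<comment> \<open>After meeting the upper boundary the path follows it, so it ends at height
    \<open>min (p a + (b - a)) (q b)\<close>. Subtracting the initial height \<open>p a\<close>
    gives the claimed rank.\<close>
  define g where "g k = min (p a + (k - a)) (q k)" for k
  have gstep: "g k \<le> g (Suc k) \<and> g (Suc k) \<le> Suc (g k)" if "a \<le> k" "k < b" for k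
    using q_step[of k] that ab by (auto simp: g_def Suc_diff_le)
  define J where "J = {x \<in> E. (a < pos x \<and> pos x \<le> b) \<and> g (pos x - 1) < g (pos x)}"
  have count: "card {x \<in> J. c < pos x \<and> pos x \<le> d} = g d - g c \<and> g c \<le> g d"
    if "a \<le> c" "c \<le> d" "d \<le> b" for c d
  proof -
    have "{x \<in> J. c < pos x \<and> pos x \<le> d} =
        {x \<in> E. c < pos x \<and> pos x \<le> d \<and> g (pos x - 1) < g (pos x)}"
      using that by (auto simp: J_def)
    also have "card \<dots> = card {k. c < k \<and> k \<le> d \<and> g (k - 1) < g k}"
      by (rule card_pos_Collect) (use that ab in auto)
    finally show ?thesis
      using card_up_steps[of c d g] gstep that by auto
  qed
  have "indep J"
  proof (subst indep_iff, intro conjI allI impI)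
    fix c d assume cd: "c \<le> d \<and> d \<le> n"
    let ?S = "{x \<in> J. c < pos x \<and> pos x \<le> d}"
    show "card ?S + p c \<le> q d"
    proof (cases "max a c \<le> min b d")
      case True
      have "?S = {x \<in> J. max a c < pos x \<and> pos x \<le> min b d}" by (auto simp: J_def)
      then have "card ?S + g (max a c) = g (min b d)"
        using count[of "max a c" "min b d"] True by auto
      moreover have "g (min b d) \<le> q d"
        using q_mono[of "min b d" d] cd by (auto simp: g_def)
      \<comment> \<open>The path does not fall below \<open>p\<close>: from \<open>p a\<close> it
        climbs as fast as possible, and where it follows \<open>q\<close> it is above
        \<open>p\<close> anyway.\<close>
      moreover have "p c \<le> g (max a c)"
        using p_mono[of c a] p_le_q[of a] p_le_q[of c] p_bounds[of a c] True ab cd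
        by (auto simp: g_def max_def split: if_splits)
      ultimately show ?thesis by simp
    next
      case False
      then have "?S = {}" by (auto simp: J_def)
      then show ?thesis using p_le_q[of c] q_mono[of c d] cd by (simp only: card.empty) simp
    qed
  qed (auto simp: J_def)
  moreover have "J \<subseteq> seg a b" by (auto simp: J_def seg_def)
  moreover have "card J = min (b - a) (q b - p a)"
  proof -
    have "{x \<in> J. a < pos x \<and> pos x \<le> b} = J" by (auto simp: J_def)
    then have "card J = g b - g a" using count[of a b] ab by simp
    moreover have "g a = p a" using p_le_q[of a] ab by (simp add: g_def)
    ultimately show ?thesis by (auto simp: g_def min_def)
  qed
  ultimately show "min (b - a) (q b - p a) \<le> rank indep (seg a b)"
    by (metis card_le_rank)
qed

lemma rank_ground: "rank indep E = p n"
  using rank_seg[of 0 n] unit_steps_le[OF p_steps, of n] by (simp add: seg_ground p_0 ends_meet)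

text \<open>\<open>C\<close> violates the inequality of some interval. The part of \<open>C\<close>
  in it is already dependent, so it is all of \<open>C\<close>. Since \<open>C\<close> exceeds its
  own rank by just one, it exceeds the bound \<open>q b - p a\<close> by just one and has the rank
  of the whole segment.\<close>

lemma circuit_spans_seg:
  assumes C: "circuit E indep C"
  obtains a b where "a < b" "b \<le> n" "C \<subseteq> seg a b" "seg a b \<subseteq> cl C" "card C + p a = Suc (q b)"
proof -
  note CE = circuit_subset[OF C]
  have "\<not> indep C" using circuit_not_indep[OF C] by auto
  then obtain a b where ab: "a \<le> b" "b \<le> n"
    and viol: "q b < card {x \<in> C. a < pos x \<and> pos x \<le> b} + p a"
    using CE indep_iff[of C] by (auto simp: not_le)
  let ?S = "{x \<in> C. a < pos x \<and> pos x \<le> b}"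
  have "\<not> indep ?S"
  proof
    assume "indep ?S"
    moreover have "?S \<inter> seg a b = ?S" using CE by (auto simp: seg_def)
    ultimately show False using card_indep_seg[of ?S a b] ab viol by simp
  qed
  then have "\<not> ?S \<subset> C" using C unfolding circuit_def by blast
  then have within: "a < pos x \<and> pos x \<le> b" if "x \<in> C" for x using that by blast
  then have S: "?S = C" by blast
  have sub: "C \<subseteq> seg a b" using within CE unfolding seg_def by blast
  have pq: "p a \<le> q b" using p_le_q[of a] q_mono[of a b] ab by auto
  have "rank indep C \<le> rank indep (seg a b)" by (rule rank_mono[OF sub])
  moreover have "rank indep (seg a b) \<le> q b - p a" using rank_seg[OF ab] by simp
  ultimately have r: "rank indep (seg a b) = rank indep C" "card C + p a = Suc (q b)"
    using circuit_rank[OF C] viol pq unfolding S by linarith+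
  have "seg a b \<subseteq> cl C"
  proof
    fix x assume x: "x \<in> seg a b"
    then have "rank indep (insert x C) \<le> rank indep (seg a b)" using sub by (intro rank_mono) auto
    then show "x \<in> cl C"
      using x r(1) seg_subset rank_insert_ge[of C x] by (auto simp: cl_def)
  qed
  moreover have "a < b"
  proof (rule ccontr)
    assume "\<not> a < b"
    then have "seg a b = {}" by (auto simp: seg_def)
    then show False using sub circuit_nonempty[OF C] by simp
  qed
  ultimately show ?thesis using that ab sub r(2) by blast
qed

section \<open>Corners and connected flats\<close>

text \<open>An East step of the upper path followed by a North step. As \<open>q b\<close> is the
  rank of \<open>seg 0 b\<close>, the last element of this segment is not a coloop and the next
  element is outside the closure. A lower corner says the same of \<open>seg a n\<close>, read from
  its left end.\<close>

definition upper_corner :: "nat \<Rightarrow> bool" where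
  "upper_corner b \<longleftrightarrow> 0 < b \<and> b < n \<and> q (b - 1) = q b \<and> q (Suc b) = Suc (q b)"

definition lower_corner :: "nat \<Rightarrow> bool" where
  "lower_corner a \<longleftrightarrow> 0 < a \<and> a < n \<and> p a = Suc (p (a - 1)) \<and> p (Suc a) = p a"

text \<open>Two elements of the flat share a circuit inside it. The segment spanned by this circuit
  lies in its closure, hence in the flat, so the flat has no gaps.\<close>

lemma connected_flat_is_seg:
  assumes X: "connected_flat E indep X" "nontrivial indep X"
  obtains a b where "a < b" "b \<le> n" "X = seg a b"
proof -
  have flat: "X \<subseteq> E" "cl X \<subseteq> X" using X(1) by (auto simp: connected_flat_def flat_iff_cl)
  have conn: "\<exists>C. circuit E indep C \<and> C \<subseteq> X \<and> x \<in> C \<and> y \<in> C"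
    if "x \<in> X" "y \<in> X" "x \<noteq> y" for x y
    using X(1) that connected_restrict_iff[OF flat(1)] by (auto simp: connected_flat_def)
  have convex: "z \<in> X" if xyz: "x \<in> X" "y \<in> X" "z \<in> E" "pos x < pos z" "pos z \<le> pos y" for x y z
  proof -
    obtain C where C: "circuit E indep C" "C \<subseteq> X" "x \<in> C" "y \<in> C"
      using conn[of x y] xyz by fastforce
    obtain a b where "C \<subseteq> seg a b" "seg a b \<subseteq> cl C" by (rule circuit_spans_seg[OF C(1)])
    moreover have "cl C \<subseteq> X" using cl_mono[OF C(2)] flat(2) by auto
    moreover have "z \<in> seg a b" if "x \<in> seg a b" "y \<in> seg a b"
      using that xyz by (auto simp: seg_def)
    ultimately show ?thesis using C(3,4) by blast
  qed
  have fin: "finite X" using flat(1) finite_ground by (rule finite_subset)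
  have ne: "X \<noteq> {}" using X(2) indep_empty by (auto simp: nontrivial_def)
  have "Min (pos ` X) \<in> pos ` X" "Max (pos ` X) \<in> pos ` X" using fin ne by simp_all
  then obtain x y where "x \<in> X" "pos x = Min (pos ` X)" and "y \<in> X" "pos y = Max (pos ` X)"
    by (elim imageE) simp
  then have x: "x \<in> X" "\<And>z. z \<in> X \<Longrightarrow> pos x \<le> pos z" and y: "y \<in> X" "\<And>z. z \<in> X \<Longrightarrow> pos z \<le> pos y"
    using fin by simp_all
  \<comment> \<open>The left cut lies just before the first element.\<close>
  have "X = seg (pos x - 1) (pos y)"
  proof (intro equalityI subsetI)
    fix z assume z: "z \<in> X"
    then have zE: "z \<in> E" using flat(1) by auto
    have "pos x - 1 < pos z" using pos_range[OF zE] x(2)[OF z] by linarith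
    then show "z \<in> seg (pos x - 1) (pos y)" using zE y(2)[OF z] by (simp add: seg_def)
  next
    fix z assume z: "z \<in> seg (pos x - 1) (pos y)"
    show "z \<in> X"
    proof (cases "z = x")
      case False
      then have "pos z \<noteq> pos x" using z x(1) flat(1) pos_inj by (auto simp: seg_def)
      then show ?thesis using convex[of x y z] z x(1) y(1) by (auto simp: seg_def)
    qed (use x in simp)
  qed
  moreover have xyE: "x \<in> E" "y \<in> E" using x(1) y(1) flat(1) by auto
  moreover have "pos x - 1 < pos y" using pos_range[OF xyE(1)] x(2)[OF y(1)] by linarith
  moreover have "pos y \<le> n" using pos_range[OF xyE(2)] by simp
  ultimately show ?thesis using that by blast
qed

text \<open>Where the paths touch, the matroid splits. A circuit through positions \<open>s\<close>
  and \<open>Suc s\<close> is cut into two independent parts with at most \<open>q s - p a\<close>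
  and \<open>q b - p s\<close> elements, yet it has \<open>q b - p a + 1\<close> elements.\<close>

lemma p_less_q:
  assumes conn: "connected_matroid E indep" and s: "0 < s" "s < n"
  shows "p s < q s"
proof -
  obtain x where x: "x \<in> E" "pos x = s" using pos_surj[of s] s by auto
  obtain y where y: "y \<in> E" "pos y = Suc s" using pos_surj[of "Suc s"] s by auto
  obtain C where C: "circuit E indep C" "x \<in> C" "y \<in> C"
    using conn x y unfolding connected_matroid_def by (metis n_not_Suc_n)
  obtain a b where ab: "a < b" "b \<le> n" "C \<subseteq> seg a b" "card C + p a = Suc (q b)"
    by (rule circuit_spans_seg[OF C(1)])
  have as: "a < s" "s < b" using C(2,3) x y ab(3) by (auto simp: seg_def)
  have "x \<notin> seg s b" "y \<notin> seg a s" using x y by (auto simp: seg_def)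
  then have "indep (C \<inter> seg a s)" "indep (C \<inter> seg s b)"
    using C(2,3) by (auto intro: indep_mono[OF circuit_minimal[OF C(1)]])
  then have "card (C \<inter> seg a s \<inter> seg a s) + p a \<le> q s" "card (C \<inter> seg s b \<inter> seg s b) + p s \<le> q b"
    using as ab(2) by (auto intro!: card_indep_seg simp del: inf.right_idem)
  then have "card (C \<inter> seg a s) + p a \<le> q s" "card (C \<inter> seg s b) + p s \<le> q b"
    by (simp_all only: inf.right_idem)
  moreover have "card C = card (C \<inter> seg a s) + card (C \<inter> seg s b)"
  proof -
    have "C = (C \<inter> seg a s) \<union> (C \<inter> seg s b)" using ab(3) by (auto simp: seg_def)
    moreover have "(C \<inter> seg a s) \<inter> (C \<inter> seg s b) = {}" by (auto simp: seg_def)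
    ultimately show ?thesis
      using card_Un_disjoint[of "C \<inter> seg a s" "C \<inter> seg s b"] finite_seg by (metis finite_Int)
  qed
  ultimately show ?thesis using ab(4) by linarith
qed

text \<open>The end elements lie on a common circuit, so dropping either one keeps the rank; a
  neighbour outside raises it because the segment is a flat. Inserted into the formula for the rank
  of segments, these facts are the corner conditions.\<close>

lemma connected_flat_seg_corners:
  assumes X: "connected_flat E indep (seg a b)" and ab: "a < b" "b \<le> n" and card: "1 < b - a"
  shows "q b + a < p a + b \<and> (b = n \<or> upper_corner b) \<and> (a = 0 \<or> lower_corner a)"
proof -
  let ?r = "rank indep"
  have flat: "cl (seg a b) \<subseteq> seg a b" using X by (auto simp: connected_flat_def flat_iff_cl)
  have conn: "\<exists>C. circuit E indep C \<and> C \<subseteq> seg a b \<and> x \<in> C \<and> y \<in> C"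
    if "x \<in> seg a b" "y \<in> seg a b" "x \<noteq> y" for x y
    using X that connected_restrict_iff[OF seg_subset] by (auto simp: connected_flat_def)
  obtain x where x: "x \<in> E" "pos x = Suc a" using pos_surj[of "Suc a"] ab by auto
  obtain y where y: "y \<in> E" "pos y = b" using pos_surj[of b] ab by auto
  have xy: "x \<in> seg a b" "y \<in> seg a b" "x \<noteq> y" using x y ab card by (auto simp: seg_def)
  then obtain C where C: "circuit E indep C" "C \<subseteq> seg a b" "x \<in> C" "y \<in> C" using conn by blast
  have sx: "insert x (seg (Suc a) b) = seg a b" and sy: "insert y (seg a (b - 1)) = seg a b"
    using x y ab pos_inj by (auto simp: seg_def) (metis Suc_lessI, metis Suc_pred le_antisym less_Suc_eq_le not_less_zero neq0_conv not_less)
  have "x \<in> cl (seg (Suc a) b)"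
    by (rule circuit_imp_cl[OF C(1,3)]) (use C(2) sx in auto)
  then have rx: "?r (seg (Suc a) b) = ?r (seg a b)" unfolding cl_def mem_Collect_eq sx by simp
  have "y \<in> cl (seg a (b - 1))"
    by (rule circuit_imp_cl[OF C(1,4)]) (use C(2) sy in auto)
  then have ry: "?r (seg a (b - 1)) = ?r (seg a b)" unfolding cl_def mem_Collect_eq sy by simp
  have r: "?r (seg a b) = min (b - a) (q b - p a)" using rank_seg ab by simp
  \<comment> \<open>Dropping an element without losing rank rules out the value \<open>b - a\<close>
    of the minimum.\<close>
  have "?r (seg a b) \<le> b - 1 - a" using ry rank_seg[of a "b - 1"] ab by simp
  then have rank: "?r (seg a b) = q b - p a" "q b - p a < b - a" using r ab by auto
  have pq: "p a \<le> q b" using p_le_q[of a] q_mono[of a b] ab by auto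
  have "upper_corner b" if bn: "b < n"
  proof -
    have "?r (seg a (b - 1)) = min (b - 1 - a) (q (b - 1) - p a)"
      by (rule rank_seg) (use ab in auto)
    then have "q b - p a \<le> q (b - 1) - p a" using ry rank(1) by linarith
    moreover have "q (b - 1) \<le> q b" using q_mono[of "b - 1" b] ab by auto
    moreover have "q a \<le> q (b - 1)" by (rule q_mono) (use ab in auto)
    moreover have "p a \<le> q a" using p_le_q[of a] ab by simp
    ultimately have 1: "q (b - 1) = q b" using pq by linarith
    obtain z where z: "z \<in> E" "pos z = Suc b" using pos_surj[of "Suc b"] bn by auto
    have "z \<notin> cl (seg a b)" using flat z by (auto simp: seg_def)
    then have "?r (seg a b) < ?r (insert z (seg a b))"
      using z(1) rank_insert_ge[of "seg a b" z] by (auto simp: cl_def)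
    also have "\<dots> \<le> ?r (seg a (Suc b))" using z ab by (intro rank_mono) (auto simp: seg_def)
    also have "\<dots> \<le> q (Suc b) - p a" using rank_seg[of a "Suc b"] ab bn by simp
    finally have "q (Suc b) = Suc (q b)" using rank(1) q_step[of b] bn by linarith
    then show ?thesis using 1 bn ab by (simp add: upper_corner_def)
  qed
  moreover have "lower_corner a" if a0: "0 < a"
  proof -
    have "?r (seg (Suc a) b) = min (b - Suc a) (q b - p (Suc a))"
      by (rule rank_seg) (use ab in auto)
    then have "q b - p a \<le> q b - p (Suc a)" using rx rank(1) by linarith
    moreover have "p a \<le> p (Suc a)" using p_mono[of a "Suc a"] ab by auto
    moreover have "p (Suc a) \<le> q b" using p_le_q[of "Suc a"] q_mono[of "Suc a" b] ab by auto
    ultimately have 1: "p (Suc a) = p a" using pq by linarith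
    obtain z where z: "z \<in> E" "pos z = a" using pos_surj[of a] a0 ab by auto
    have "z \<notin> cl (seg a b)" using flat z by (auto simp: seg_def)
    then have "?r (seg a b) < ?r (insert z (seg a b))"
      using z(1) rank_insert_ge[of "seg a b" z] by (auto simp: cl_def)
    also have "\<dots> \<le> ?r (seg (a - 1) b)" using z ab a0 by (intro rank_mono) (auto simp: seg_def)
    also have "?r (seg (a - 1) b) = min (b - (a - 1)) (q b - p (a - 1))"
      by (rule rank_seg) (use ab in auto)
    also have "\<dots> \<le> q b - p (a - 1)" by simp
    finally have "q b - p a < q b - p (a - 1)" using rank(1) by simp
    moreover have "p a \<le> Suc (p (a - 1))" using p_bounds[of "a - 1" a] a0 ab by simp
    ultimately have "p a = Suc (p (a - 1))" by linarith
    then show ?thesis using 1 a0 ab by (simp add: lower_corner_def)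
  qed
  moreover have "q b + a < p a + b" using rank pq ab by linarith
  ultimately show ?thesis using ab(2) le_neq_implies_less by blast
qed

text \<open>If the closure contained an \<open>e\<close> outside, a circuit would join
  \<open>e\<close> to some \<open>f\<close> in the segment, and the segment spanned by this circuit
  would place the outer neighbour of the segment on that side in the closure. At a corner, however,
  this neighbour raises the rank.\<close>

lemma seg_flat:
  assumes loopless: "\<And>x. x \<in> E \<Longrightarrow> indep {x}" and ab: "a < b" "b \<le> n"
    and dep: "q b + a < p a + b"
    and b: "b = n \<or> upper_corner b" and a: "a = 0 \<or> lower_corner a"
  shows "flat E indep (seg a b)"
proof -
  let ?X = "seg a b"
  have rX: "rank indep ?X = q b - p a" using rank_seg[of a b] ab dep by (auto simp: min_def)
  have pq: "p a \<le> q b" using p_le_q[of a] q_mono[of a b] ab by auto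
  have "cl ?X \<subseteq> ?X"
  proof (rule ccontr)
    assume "\<not> ?thesis"
    then obtain e where e: "e \<in> cl ?X" "e \<notin> ?X" by auto
    have eE: "e \<in> E" using e(1) cl_subset_ground by auto
    obtain C where C: "circuit E indep C" "e \<in> C" "C \<subseteq> insert e ?X"
      using e seg_subset by (rule cl_imp_circuit)
    obtain c d where cd: "c < d" "d \<le> n" "C \<subseteq> seg c d" "seg c d \<subseteq> cl C"
      by (rule circuit_spans_seg[OF C(1)])
    have "C \<subseteq> cl ?X" using C(3) e(1) subset_cl[OF seg_subset, of a b] by auto
    then have sub: "seg c d \<subseteq> cl ?X" using cd(4) cl_least[OF _ seg_subset, of C a b] by blast
    have "C \<noteq> {e}" using loopless[OF eE] circuit_not_indep[OF C(1)] by auto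
    then obtain f where f: "f \<in> C" "f \<in> ?X" using C(2,3) by auto
    have ce: "c < pos e" "pos e \<le> d" and cf: "c < pos f" "pos f \<le> d"
      using cd(3) C(2) f(1) by (auto simp: seg_def)
    have af: "a < pos f" "pos f \<le> b" using f(2) by (auto simp: seg_def)
    have "pos e \<le> a \<or> b < pos e" using e(2) eE by (auto simp: seg_def)
    then show False
    proof
      assume "b < pos e"
      then have bn: "b < n" using pos_range[OF eE] by simp
      then have corner: "q (Suc b) = Suc (q b)" using b by (auto simp: upper_corner_def)
      obtain z where z: "z \<in> E" "pos z = Suc b" using pos_surj[of "Suc b"] bn by auto
      have "z \<in> cl ?X" using sub z \<open>b < pos e\<close> ce cf af by (auto simp: seg_def)
      moreover have "insert z ?X = seg a (Suc b)"
        using z ab pos_inj by (auto simp: seg_def le_Suc_eq)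
      ultimately have "rank indep (seg a (Suc b)) = q b - p a" using rX by (simp add: cl_def)
      then show False using rank_seg[of a "Suc b"] ab bn corner dep pq by (auto simp: min_def split: if_splits)
    next
      assume "pos e \<le> a"
      then have a0: "0 < a" using pos_range[OF eE] by simp
      then have corner: "p a = Suc (p (a - 1))" using a by (auto simp: lower_corner_def)
      obtain z where z: "z \<in> E" "pos z = a" using pos_surj[of a] a0 ab by auto
      have "z \<in> cl ?X" using sub z \<open>pos e \<le> a\<close> ce cf af by (auto simp: seg_def)
      moreover have "insert z ?X = seg (a - 1) b"
      proof -
        have "pos x = a \<longleftrightarrow> x = z" if "x \<in> E" for x
          using that z pos_inj[of x z] by auto
        moreover have "a - 1 < k \<longleftrightarrow> k = a \<or> a < k" for k using a0 by auto
        ultimately show ?thesis using z(1) ab unfolding seg_def by fastforce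
      qed
      ultimately have "rank indep (seg (a - 1) b) = q b - p a" using rX by (simp add: cl_def)
      moreover have "rank indep (seg (a - 1) b) = min (b - (a - 1)) (q b - p (a - 1))"
        by (rule rank_seg) (use ab in auto)
      ultimately show False using ab a0 corner dep pq by linarith
    qed
  qed
  then show ?thesis using seg_subset by (simp add: flat_iff_cl)
qed

text \<open>Since lying on a common circuit is transitive, it suffices to link neighbours. A rank
  count gives a circuit crossing the cut between them; its closure is connected and contains
  both.\<close>

lemma seg_connected_flat:
  assumes conn: "connected_matroid E indep" and n: "2 \<le> n" and ab: "a < b" "b \<le> n"
    and dep: "q b + a < p a + b"
    and b: "b = n \<or> upper_corner b" and a: "a = 0 \<or> lower_corner a"
  shows "connected_flat E indep (seg a b)"
proof -
  let ?X = "seg a b"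
  have loopless: "indep {x}" if "x \<in> E" for x
  proof -
    have "card (E - {x}) \<noteq> 0" using card_ground n that finite_ground by simp
    then obtain y where "y \<in> E" "y \<noteq> x" by (metis Diff_iff card.empty ex_in_conv insertCI)
    then show ?thesis using connected_imp_loopless[OF conn that, of y] by auto
  qed
  have flat: "flat E indep ?X" by (rule seg_flat[OF loopless ab dep b a])
  then have clX: "cl ?X \<subseteq> ?X" by (simp add: flat_iff_cl)
  define linked where "linked x y \<longleftrightarrow> (\<exists>C. circuit E indep C \<and> C \<subseteq> ?X \<and> x \<in> C \<and> y \<in> C)" for x y
  have trans: "linked x z" if "linked x y" "linked y z" for x y z
  proof -
    obtain C where C: "circuit E indep C" "C \<subseteq> ?X" "x \<in> C" "y \<in> C"
      using \<open>linked x y\<close> by (auto simp: linked_def)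
    obtain D where D: "circuit E indep D" "D \<subseteq> ?X" "y \<in> D" "z \<in> D"
      using \<open>linked y z\<close> by (auto simp: linked_def)
    obtain C' where "circuit E indep C'" "x \<in> C'" "z \<in> C'" "C' \<subseteq> C \<union> D"
      using circuits_meet_imp_common_circuit[OF C(1) D(1) C(3) D(4)] C(4) D(3) by auto
    then show ?thesis using C(2) D(2) unfolding linked_def by blast
  qed
  have sym: "linked x y \<Longrightarrow> linked y x" for x y by (auto simp: linked_def)
  have adjacent: "linked x y" if x: "x \<in> E" "pos x = s" and y: "y \<in> E" "pos y = Suc s"
    and s: "a < s" "s < b" for x y s
  proof -
    have "rank indep ?X < rank indep (seg a s) + rank indep (seg s b)"
    proof -
      \<comment> \<open>Each of the two summands is a minimum of two terms. The four combinations
        exceed \<open>q b - p a\<close> by \<open>1\<close>, \<open>2\<close>, \<open>3\<close> and,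
        for \<open>(s - a) + (b - s)\<close>, by \<open>dep\<close>.\<close>
      have 1: "p s < q s" using p_less_q[OF conn, of s] s ab by simp
      have 2: "p s + a < p a + s"
      proof (cases "a = 0")
        case True
        then show ?thesis using 1 unit_steps_le[OF q_steps, of s] s ab by (simp add: p_0)
      next
        case False
        then show ?thesis
          using a p_bounds[of "Suc a" s] s ab by (auto simp: lower_corner_def)
      qed
      have 3: "q b + s < q s + b"
      proof (cases "b = n")
        case True
        then show ?thesis using 1 p_bounds[of s n] s ab ends_meet by auto
      next
        case False
        then have "q (b - 1) = q b" using b by (simp add: upper_corner_def)
        moreover have "q (b - 1) \<le> q s + (b - 1 - s)"
          using q_bounds[of s "b - 1"] s ab by linarith
        ultimately show ?thesis using s by linarith
      qed
      have "p a \<le> q s" "p s \<le> q b" "p a \<le> q b"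
        using p_le_q[of a] q_mono[of a s] p_le_q[of s] q_mono[of s b] q_mono[of a b] s ab by auto
      moreover have "rank indep ?X = min (b - a) (q b - p a)"
        "rank indep (seg a s) = min (s - a) (q s - p a)"
        "rank indep (seg s b) = min (b - s) (q b - p s)"
        using s ab by (auto intro!: rank_seg)
      ultimately show ?thesis using s dep 1 2 3 by linarith
    qed
    moreover have un: "seg a s \<union> seg s b = ?X" "seg a s \<inter> seg s b = {}"
      using s by (auto simp: seg_def)
    ultimately obtain C where C: "circuit E indep C" "C \<subseteq> ?X" "C \<inter> seg a s \<noteq> {}" "C \<inter> seg s b \<noteq> {}"
      using circuit_meets_both_if_rank_less[of "seg a s" "seg s b"] seg_subset by (metis Un_least)
    obtain c d where cd: "c < d" "d \<le> n" "C \<subseteq> seg c d" "seg c d \<subseteq> cl C"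
      by (rule circuit_spans_seg[OF C(1)])
    \<comment> \<open>A circuit with elements on both sides of the cut spans a segment that contains
      the elements at \<open>s\<close> and \<open>Suc s\<close>.\<close>
    have "c < s" "s < d" using C(3,4) cd(3) by (auto simp: seg_def)
    then have xy: "x \<in> cl C" "y \<in> cl C" using cd(4) x y by (auto simp: seg_def)
    have clC: "cl C \<subseteq> ?X" using cl_mono[OF C(2)] clX by auto
    have "connected_matroid (cl C) (restrict_indep indep (cl C))"
      by (rule connected_cl_circuit[OF C(1)]) (use loopless cl_subset_ground in auto)
    then have "\<forall>x\<in>cl C. \<forall>y\<in>cl C. x \<noteq> y \<longrightarrow> (\<exists>D. circuit E indep D \<and> D \<subseteq> cl C \<and> x \<in> D \<and> y \<in> D)"
      by (rule iffD1[OF connected_restrict_iff[OF cl_subset_ground]])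
    moreover have "x \<noteq> y" using x(2) y(2) by auto
    ultimately have "\<exists>D. circuit E indep D \<and> D \<subseteq> cl C \<and> x \<in> D \<and> y \<in> D"
      using xy by simp
    then show ?thesis using clC unfolding linked_def by fastforce
  qed
  have up: "x \<in> E \<Longrightarrow> y \<in> E \<Longrightarrow> a < pos x \<Longrightarrow> pos y = pos x + Suc k \<Longrightarrow> pos y \<le> b \<Longrightarrow> linked x y" for x y k
  proof (induction k arbitrary: y)
    case 0
    then show ?case using adjacent[of x "pos x" y] by simp
  next
    case (Suc k)
    obtain z where z: "z \<in> E" "pos z = pos x + Suc k"
      using pos_surj[of "pos x + Suc k"] Suc.prems ab by auto
    then have "linked x z" using Suc by simp
    moreover have "linked z y" using adjacent[of z "pos x + Suc k" y] z Suc.prems by simp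
    ultimately show ?case by (rule trans)
  qed
  have "linked x y" if xy: "x \<in> ?X" "y \<in> ?X" "x \<noteq> y" for x y
  proof -
    have "pos x \<noteq> pos y" using xy pos_inj by (auto simp: seg_def)
    then consider "pos x < pos y" | "pos y < pos x" by linarith
    then show ?thesis
    proof cases
      case 1
      then obtain k where "pos y = pos x + Suc k" using less_imp_Suc_add by fastforce
      then show ?thesis using up[of x y k] xy by (auto simp: seg_def)
    next
      case 2
      then obtain k where "pos x = pos y + Suc k" using less_imp_Suc_add by fastforce
      then show ?thesis using sym[OF up[of y x k]] xy by (auto simp: seg_def)
    qed
  qed
  then show ?thesis
    unfolding connected_flat_def using flat connected_restrict_iff[OF seg_subset]
    by (auto simp: linked_def)
qed

end

section \<open>Fundamental flats of lattice path matroids\<close>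

context interval_matroid
begin

text \<open>Rotating the region by 180 degrees exchanges the boundary paths and measures heights
  downwards from \<open>p n\<close>. Constructions along \<open>q\<close> thereby carry over to
  \<open>p\<close>.\<close>

lemma reversed:
  "interval_matroid E indep (\<lambda>x. Suc n - pos x) n (\<lambda>k. p n - q (n - k)) (\<lambda>k. p n - p (n - k))"
proof unfold_locales
  show "bij_betw (\<lambda>x. Suc n - pos x) E {1..n}"
  proof (rule bij_betw_imageI)
    show "inj_on (\<lambda>x. Suc n - pos x) E"
    proof (rule inj_onI)
      fix x y assume xy: "x \<in> E" "y \<in> E" "Suc n - pos x = Suc n - pos y"
      then have "pos x = pos y" using pos_range[of x] pos_range[of y] by linarith
      then show "x = y" using xy pos_inj by blast
    qed
    show "(\<lambda>x. Suc n - pos x) ` E = {1..n}"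
    proof (intro equalityI subsetI)
      fix k assume "k \<in> (\<lambda>x. Suc n - pos x) ` E"
      then obtain x where x: "x \<in> E" "k = Suc n - pos x" by auto
      then show "k \<in> {1..n}" using pos_range[of x] by auto
    next
      fix k assume "k \<in> {1..n}"
      then have k: "1 \<le> k" "k \<le> n" by auto
      have "0 < Suc n - k" "Suc n - k \<le> n" using k by linarith+
      then obtain x where "x \<in> E" "pos x = Suc n - k" by (rule pos_surj)
      then show "k \<in> (\<lambda>x. Suc n - pos x) ` E" using k by (intro image_eqI[of _ _ x]) auto
    qed
  qed
  show "unit_steps n (\<lambda>k. p n - q (n - k))"
    unfolding unit_steps_def
  proof (intro conjI allI impI)
    fix k assume k: "k < n"
    have "q (n - Suc k) \<le> q (n - k) \<and> q (n - k) \<le> q (n - Suc k) + (n - k - (n - Suc k))"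
      by (rule q_bounds) auto
    moreover have "q (n - k) \<le> q n" by (rule q_mono) auto
    ultimately show "p n - q (n - k) \<le> p n - q (n - Suc k)"
      "p n - q (n - Suc k) \<le> Suc (p n - q (n - k))" using ends_meet k by linarith+
  qed (simp add: ends_meet)
  show "unit_steps n (\<lambda>k. p n - p (n - k))"
    unfolding unit_steps_def
  proof (intro conjI allI impI)
    fix k assume k: "k < n"
    have "p (n - Suc k) \<le> p (n - k) \<and> p (n - k) \<le> p (n - Suc k) + (n - k - (n - Suc k))"
      by (rule p_bounds) auto
    moreover have "p (n - k) \<le> p n" by (rule p_mono) auto
    ultimately show "p n - p (n - k) \<le> p n - p (n - Suc k)"
      "p n - p (n - Suc k) \<le> Suc (p n - p (n - k))" using k by linarith+
  qed simp
  show "p n - q (n - n) = p n - p (n - n)" by (simp add: p_0 q_0)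
  fix I
  have step: "card {x \<in> I. a < Suc n - pos x \<and> Suc n - pos x \<le> b} + (p n - q (n - a)) \<le> p n - p (n - b) \<longleftrightarrow>
      card {x \<in> I. n - b < pos x \<and> pos x \<le> n - a} + p (n - b) \<le> q (n - a)"
    if I: "I \<subseteq> E" and ab: "a \<le> b" "b \<le> n" for a b
  proof -
    have "a < Suc n - pos x \<and> Suc n - pos x \<le> b \<longleftrightarrow> n - b < pos x \<and> pos x \<le> n - a"
      if "x \<in> I" for x
    proof -
      have "x \<in> E" using that I by auto
      then show ?thesis using pos_range[of x] ab by auto
    qed
    then have eq: "{x \<in> I. a < Suc n - pos x \<and> Suc n - pos x \<le> b} = {x \<in> I. n - b < pos x \<and> pos x \<le> n - a}"
      by blast
    have "q (n - a) \<le> q n" "p (n - b) \<le> p n" by (rule q_mono p_mono; simp)+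
    then show ?thesis unfolding eq using ends_meet by (intro iffI) linarith+
  qed
  show "indep I \<longleftrightarrow> I \<subseteq> E \<and> (\<forall>a b. a \<le> b \<and> b \<le> n \<longrightarrow>
      card {x \<in> I. a < Suc n - pos x \<and> Suc n - pos x \<le> b} + (p n - q (n - a)) \<le> p n - p (n - b))"
    (is "_ \<longleftrightarrow> _ \<and> ?R")
  proof (cases "I \<subseteq> E")
    case True
    have "?R \<longleftrightarrow> (\<forall>a b. a \<le> b \<and> b \<le> n \<longrightarrow> card {x \<in> I. a < pos x \<and> pos x \<le> b} + p a \<le> q b)"
    proof (intro iffI allI impI)
      fix a b assume R: ?R and ab: "a \<le> b \<and> b \<le> n"
      have "n - b \<le> n - a" "n - a \<le> n" "n - (n - a) = a" "n - (n - b) = b" using ab by auto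
      then show "card {x \<in> I. a < pos x \<and> pos x \<le> b} + p a \<le> q b"
        using step[OF True, of "n - b" "n - a"] R[rule_format, of "n - b" "n - a"] by simp
    next
      fix a b assume R: "\<forall>a b. a \<le> b \<and> b \<le> n \<longrightarrow> card {x \<in> I. a < pos x \<and> pos x \<le> b} + p a \<le> q b"
        and ab: "a \<le> b \<and> b \<le> n"
      have "n - b \<le> n - a" "n - a \<le> n" using ab by auto
      then show "card {x \<in> I. a < Suc n - pos x \<and> Suc n - pos x \<le> b} + (p n - q (n - a)) \<le> p n - p (n - b)"
        using step[OF True, of a b] R[rule_format, of "n - b" "n - a"] ab by blast
    qed
    then show ?thesis using indep_iff[of I] True by simp
  qed (use indep_subset_ground in blast)
qed

text \<open>The North steps of the upper path form a basis that fills each initial segment up to its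
  rank. The last element closes it to a circuit, and only there the count deviates, hence
  \<open>b < n\<close>.\<close>

lemma spanning_circuit_along_q:
  assumes conn: "connected_matroid E indep" and n: "2 \<le> n"
  shows "\<exists>C. spanning_circuit E indep C \<and> (\<forall>b<n. card (C \<inter> seg 0 b) = q b)"
proof -
  define C where "C = {x \<in> E. q (pos x - 1) < q (pos x) \<or> pos x = n}"
  have CE: "C \<subseteq> E" by (auto simp: C_def)
  have fin: "finite C" using CE finite_ground by (rule finite_subset)
  \<comment> \<open>The upper path ends with an East step since it stays off the lower one; so the
    last element is not already among the North steps.\<close>
  have q_last: "q (n - 1) = q n"
  proof -
    have "p (n - 1) < q (n - 1)" using p_less_q[OF conn, of "n - 1"] n by simp
    moreover have "p n \<le> Suc (p (n - 1))" using p_bounds[of "n - 1" n] n by simp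
    moreover have "q (n - 1) \<le> q n" by (rule q_mono) auto
    ultimately show ?thesis using ends_meet by linarith
  qed
  have inner: "card (C \<inter> seg a b) = q b - q a" if "a \<le> b" "b < n" for a b
  proof -
    have "C \<inter> seg a b = {x \<in> E. a < pos x \<and> pos x \<le> b \<and> q (pos x - 1) < q (pos x)}"
      using that by (auto simp: C_def seg_def)
    also have "card \<dots> = card {k. a < k \<and> k \<le> b \<and> q (k - 1) < q k}"
      by (rule card_pos_Collect) (use that in auto)
    finally show ?thesis using card_up_steps[of a b q] q_step that by auto
  qed
  have last: "card (C \<inter> seg a n) = Suc (q n - q a)" if a: "a < n" for a
  proof -
    obtain z where z: "z \<in> E" "pos z = n" using pos_surj[of n] n by auto
    have "pos x = n \<longleftrightarrow> x = z" if "x \<in> E" for x using that z pos_inj[of x z] by auto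
    moreover have "k \<le> n \<longleftrightarrow> k \<le> n - 1 \<or> k = n" for k using n by auto
    ultimately have "C \<inter> seg a n = insert z (C \<inter> seg a (n - 1))"
      using z a unfolding C_def seg_def by fastforce
    moreover have "z \<notin> seg a (n - 1)" using z n by (auto simp: seg_def)
    ultimately have "card (C \<inter> seg a n) = Suc (card (C \<inter> seg a (n - 1)))"
      using fin by simp
    also have "card (C \<inter> seg a (n - 1)) = q (n - 1) - q a"
      using a by (intro inner) auto
    finally show ?thesis unfolding q_last .
  qed
  have card_C: "card C = Suc (p n)"
    using last[of 0] n CE by (simp add: seg_ground q_0 ends_meet Int_absorb2)
  have minus: "indep (C - {c})" if c: "c \<in> C" for c
  proof (subst indep_iff, intro conjI allI impI)
    show "C - {c} \<subseteq> E" using CE by auto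
    fix a b assume ab: "a \<le> b \<and> b \<le> n"
    let ?S = "{x \<in> C - {c}. a < pos x \<and> pos x \<le> b}"
    have "?S \<subseteq> C \<inter> seg a b" using CE by (auto simp: seg_def)
    then have le: "card ?S \<le> card (C \<inter> seg a b)" using fin by (intro card_mono) auto
    have pqa: "p a \<le> q a" using p_le_q[of a] ab by simp
    have qab: "q a \<le> q b" using q_mono[of a b] ab by simp
    \<comment> \<open>Only intervals ending at \<open>n\<close> contain the additional element. For
      \<open>a = 0\<close> it is compensated by the removed \<open>c\<close>, for
      \<open>0 < a < n\<close> by \<open>p a < q a\<close>.\<close>
    consider "b < n" | "b = n" "a = 0" | "b = n" "0 < a" "a < n" | "b = n" "a = n"
      using ab by linarith
    then show "card ?S + p a \<le> q b"
    proof cases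
      case 1
      then show ?thesis using le inner[of a b] ab pqa qab by simp
    next
      case 2
      have "card ?S \<le> card (C - {c})" using fin by (intro card_mono) auto
      then show ?thesis using 2 card_C c fin by (simp add: p_0 ends_meet)
    next
      case 3
      then show ?thesis using le last[of a] p_less_q[OF conn, of a] qab by simp
    next
      case 4
      then have "?S = {}" by auto
      then show ?thesis using 4 ends_meet by (simp only: card.empty)
    qed
  qed
  have "circuit E indep C"
    unfolding circuit_def
  proof (intro conjI allI impI)
    show "\<not> indep C" using card_le_rank[of C E] CE card_C by (auto simp: rank_ground)
    fix D assume "D \<subset> C"
    then obtain c where "c \<in> C" "D \<subseteq> C - {c}" by blast
    then show "indep D" using minus indep_mono by blast
  qed (rule CE)
  moreover from this have "rank indep C = rank indep E"
    using circuit_rank card_C by (simp add: rank_ground)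
  ultimately have "spanning_circuit E indep C" by (simp add: spanning_circuit_def)
  moreover have "card (C \<inter> seg 0 b) = q b" if "b < n" for b
    using inner[of 0 b] that by (simp add: q_0)
  ultimately show ?thesis by blast
qed

lemma spanning_circuit_along_p:
  assumes conn: "connected_matroid E indep" and n: "2 \<le> n"
  shows "\<exists>C. spanning_circuit E indep C \<and>
    (\<forall>a. 0 < a \<and> a \<le> n \<longrightarrow> card (C \<inter> seg a n) = p n - p a)"
proof -
  interpret rev: interval_matroid E indep "\<lambda>x. Suc n - pos x" n
    "\<lambda>k. p n - q (n - k)" "\<lambda>k. p n - p (n - k)"
    by (rule reversed)
  obtain C where C: "spanning_circuit E indep C"
    "\<forall>b<n. card (C \<inter> rev.seg 0 b) = p n - p (n - b)"
    using rev.spanning_circuit_along_q[OF conn n] by blast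
  have "rev.seg 0 (n - a) = seg a n" if "a \<le> n" for a
  proof -
    have "0 < Suc n - pos x \<and> Suc n - pos x \<le> n - a \<longleftrightarrow> a < pos x \<and> pos x \<le> n"
      if "x \<in> E" for x using pos_range[OF that] \<open>a \<le> n\<close> by auto
    then show ?thesis unfolding rev.seg_def seg_def by blast
  qed
  then have "card (C \<inter> seg a n) = p n - p a" if "0 < a" "a \<le> n" for a
    using spec[OF C(2), of "n - a"] that by simp
  then show ?thesis using C(1) by blast
qed

text \<open>Shows that a spanning circuit cannot contain a basis of a dependent segment between two
  corners, whose rank is \<open>q b - p a\<close>.\<close>

lemma spanning_circuit_meets_seg:
  assumes C: "spanning_circuit E indep C" and a: "lower_corner a" and b: "upper_corner b" and ab: "a < b"
  shows "card (C \<inter> seg a b) + p a < q b"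
proof -
  have circ: "circuit E indep C" and rC: "rank indep C = p n"
    using C by (simp_all add: spanning_circuit_def rank_ground)
  have card_C: "card C = Suc (p n)" using circuit_rank[OF circ] rC by simp
  note CE = circuit_subset[OF circ]
  have fin: "finite C" by (rule circuit_finite[OF circ])
  have an: "0 < a" "a < n" and pa: "0 < p a" using a by (auto simp: lower_corner_def)
  have bn: "0 < b" "b < n" using b by (auto simp: upper_corner_def)
  have "q (Suc b) \<le> q n" by (rule q_mono) (use bn in auto)
  then have qb: "q b < p n" using b ends_meet by (simp add: upper_corner_def)
  have pan: "p a \<le> p n" by (rule p_mono) (use an in auto)
  have split: "card C = card (C \<inter> seg 0 s) + card (C \<inter> seg s n)" if "s \<le> n" for s
  proof -
    have "C = (C \<inter> seg 0 s) \<union> (C \<inter> seg s n)" using CE pos_range that by (auto simp: seg_def)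
    moreover have "(C \<inter> seg 0 s) \<inter> (C \<inter> seg s n) = {}" by (auto simp: seg_def)
    ultimately show ?thesis using card_Un_disjoint[of "C \<inter> seg 0 s" "C \<inter> seg s n"] fin by (metis finite_Int)
  qed
  have minus: "card (C \<inter> seg c d - {x}) + p c \<le> q d" if "x \<in> C" "c \<le> d" "d \<le> n" for x c d
  proof -
    have "card ((C - {x}) \<inter> seg c d) + p c \<le> q d"
      by (rule card_indep_seg[OF circuit_minimal[OF circ that(1)] that(2,3)])
    moreover have "(C - {x}) \<inter> seg c d = C \<inter> seg c d - {x}" by auto
    ultimately show ?thesis by simp
  qed
  \<comment> \<open>Some element of \<open>C\<close> lies before \<open>a\<close>: otherwise
    \<open>C\<close> has \<open>p n + 1\<close> elements after \<open>a\<close>, and deleting one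
    leaves more than \<open>p n - p a\<close> because \<open>p a > 0\<close>. Deleting an element
    before \<open>a\<close> leaves the part after \<open>a\<close> unchanged, which thus satisfies
    the inequality for independent sets.\<close>
  have low: "card (C \<inter> seg a n) + p a \<le> p n"
  proof -
    have "C \<inter> seg 0 a \<noteq> {}"
    proof
      assume emp: "C \<inter> seg 0 a = {}"
      then have full: "card (C \<inter> seg a n) = Suc (p n)" using split[of a] an card_C by simp
      then obtain x where x: "x \<in> C \<inter> seg a n" by (metis card.empty ex_in_conv nat.distinct(1))
      then have "card (C \<inter> seg a n - {x}) + p a \<le> q n" using minus[of x a n] an by simp
      then show False using x full pa ends_meet fin by simp
    qed
    then obtain x where x: "x \<in> C" "x \<in> seg 0 a" by auto
    then have "C \<inter> seg a n - {x} = C \<inter> seg a n" by (auto simp: seg_def)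
    then show ?thesis using minus[OF x(1), of a n] an ends_meet by simp
  qed
  \<comment> \<open>The mirror image, with \<open>q b < p n\<close> in place of
    \<open>p a > 0\<close>.\<close>
  have high: "card (C \<inter> seg 0 b) \<le> q b"
  proof -
    have "C \<inter> seg b n \<noteq> {}"
    proof
      assume emp: "C \<inter> seg b n = {}"
      then have full: "card (C \<inter> seg 0 b) = Suc (p n)" using split[of b] bn card_C by simp
      then obtain x where x: "x \<in> C \<inter> seg 0 b" by (metis card.empty ex_in_conv nat.distinct(1))
      then have "card (C \<inter> seg 0 b - {x}) + p 0 \<le> q b" using minus[of x 0 b] bn by simp
      then show False using x full qb fin by simp
    qed
    then obtain x where x: "x \<in> C" "x \<in> seg b n" by auto
    then have "C \<inter> seg 0 b - {x} = C \<inter> seg 0 b" by (auto simp: seg_def)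
    then show ?thesis using minus[OF x(1), of 0 b] bn by (simp add: p_0)
  qed
  have "card (C \<inter> seg 0 b) = card (C \<inter> seg 0 a) + card (C \<inter> seg a b)"
  proof -
    have "C \<inter> seg 0 b = (C \<inter> seg 0 a) \<union> (C \<inter> seg a b)" using ab by (auto simp: seg_def)
    moreover have "(C \<inter> seg 0 a) \<inter> (C \<inter> seg a b) = {}" by (auto simp: seg_def)
    ultimately show ?thesis using card_Un_disjoint[of "C \<inter> seg 0 a" "C \<inter> seg a b"] fin by (metis finite_Int)
  qed
  then show ?thesis using low high split[of a] card_C an pan by linarith
qed

text \<open>The dependence inequality appears only for two corners. With one corner it is automatic:
  the East step next to the corner leaves the segment with more elements than its rank.\<close>

lemma proper_connected_flat_iff:
  assumes conn: "connected_matroid E indep"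
  shows "connected_flat E indep X \<and> nontrivial indep X \<and> X \<noteq> E \<longleftrightarrow>
    (\<exists>b. upper_corner b \<and> X = seg 0 b) \<or> (\<exists>a. lower_corner a \<and> X = seg a n) \<or>
    (\<exists>a b. lower_corner a \<and> upper_corner b \<and> q b + a < p a + b \<and> X = seg a b)"
    (is "?L \<longleftrightarrow> ?R")
proof
  assume L: ?L
  then obtain a b where ab: "a < b" "b \<le> n" "X = seg a b"
    using connected_flat_is_seg by blast
  have "1 < b - a"
  proof (rule ccontr)
    assume "\<not> 1 < b - a"
    then have "card X = 1" using ab card_seg[of b a] by simp
    then obtain x where x: "X = {x}" by (auto simp: card_1_singleton_iff)
    then have "x \<in> E" using ab(3) seg_subset by auto
    moreover from this obtain y where "y \<in> E" "x \<noteq> y" using L x by auto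
    ultimately have "indep {x}" using connected_imp_loopless[OF conn] by blast
    then show False using L x by (simp add: nontrivial_def)
  qed
  then have "q b + a < p a + b \<and> (b = n \<or> upper_corner b) \<and> (a = 0 \<or> lower_corner a)"
    using connected_flat_seg_corners[of a b] L ab by blast
  moreover have "a \<noteq> 0 \<or> b \<noteq> n" using L ab(3) seg_ground by auto
  ultimately show ?R using ab(3) by auto
next
  assume R: ?R
  have "\<exists>a b. X = seg a b \<and> 2 \<le> n \<and> a < b \<and> b \<le> n \<and> (a \<noteq> 0 \<or> b \<noteq> n) \<and> q b + a < p a + b \<and>
      (b = n \<or> upper_corner b) \<and> (a = 0 \<or> lower_corner a)"
    using R
  proof (elim disjE exE conjE)
    fix b assume b: "upper_corner b" "X = seg 0 b"
    then have bn: "0 < b" "b < n" "q (b - 1) = q b" by (auto simp: upper_corner_def)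
    have "q (b - 1) \<le> b - 1" by (rule unit_steps_le[OF q_steps]) (use bn in auto)
    then have "q b < b" using bn by linarith
    then show ?thesis using b bn by (intro exI[of _ 0] exI[of _ b]) (auto simp: p_0)
  next
    fix a assume a: "lower_corner a" "X = seg a n"
    then have an: "0 < a" "a < n" "p (Suc a) = p a" by (auto simp: lower_corner_def)
    have "p n \<le> p (Suc a) + (n - Suc a)" using p_bounds[of "Suc a" n] an by simp
    then have "q n + a < p a + n" using an ends_meet by linarith
    then show ?thesis using a an by (intro exI[of _ a] exI[of _ n]) auto
  next
    fix a b assume *: "lower_corner a" "upper_corner b" "q b + a < p a + b" "X = seg a b"
    then have bn: "0 < a" "0 < b" "b < n" "a < n" by (auto simp: upper_corner_def lower_corner_def)
    \<comment> \<open>The inequality forces this: \<open>q\<close> grows by at most one per step, so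
      \<open>b \<le> a\<close> would give \<open>q a \<le> q b + (a - b) < p a\<close>.\<close>
    have "a < b"
    proof (rule ccontr)
      assume "\<not> a < b"
      then have "q a \<le> q b + (a - b)" using q_bounds[of b a] bn by simp
      then show False using p_le_q[of a] bn *(3) \<open>\<not> a < b\<close> by linarith
    qed
    then show ?thesis using * bn by (intro exI[of _ a] exI[of _ b]) auto
  qed
  then obtain a b where X: "X = seg a b" and n: "2 \<le> n" and ab: "a < b" "b \<le> n" "a \<noteq> 0 \<or> b \<noteq> n"
    and dep: "q b + a < p a + b" "b = n \<or> upper_corner b" "a = 0 \<or> lower_corner a"
    by blast
  have "connected_flat E indep X"
    unfolding X by (rule seg_connected_flat[OF conn n ab(1,2) dep])
  moreover have "card X = b - a" using card_seg ab X by simp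
  moreover have "rank indep X = min (b - a) (q b - p a)" using rank_seg ab X by simp
  moreover have "card E = n" by (rule card_ground)
  ultimately show ?L
    using rank_indep[of X] dep(1) ab unfolding nontrivial_def by (auto simp: min_def split: if_splits)
qed

lemma rank_initial: "b \<le> n \<Longrightarrow> rank indep (seg 0 b) = q b"
  using rank_seg[of 0 b] unit_steps_le[OF q_steps, of b] by (simp add: p_0)

lemma rank_final: "a \<le> n \<Longrightarrow> rank indep (seg a n) = p n - p a"
  using rank_seg[of a n] p_bounds[of a n] ends_meet by linarith

text \<open>For one corner, the spanning circuit along the corresponding boundary path meets the
  flat in as many elements as its rank.\<close>

lemma fundamental_flat_iff:
  assumes conn: "connected_matroid E indep"
  shows "fundamental_flat E indep X \<longleftrightarrow>
    (\<exists>b. upper_corner b \<and> X = seg 0 b) \<or> (\<exists>a. lower_corner a \<and> X = seg a n)"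
    (is "?L \<longleftrightarrow> ?R")
proof
  assume L: ?L
  then obtain C where C: "spanning_circuit E indep C" "basis X (restrict_indep indep X) (X \<inter> C)"
    and X: "connected_flat E indep X" "1 < card X" "rank indep X < rank indep E"
    by (auto simp: fundamental_flat_def)
  have XE: "X \<subseteq> E" using X(1) by (auto simp: connected_flat_def flat_def)
  obtain x y where xy: "x \<in> X" "y \<in> X" "x \<noteq> y"
    using X(2) by (metis One_nat_def card_le_Suc0_iff_eq card.infinite leD not_less_zero)
  then obtain D where "circuit E indep D" "D \<subseteq> X"
    using X(1) connected_restrict_iff[OF XE] unfolding connected_flat_def by blast
  then have "nontrivial indep X" using circuit_not_indep by (auto simp: nontrivial_def)
  then have "(\<exists>b. upper_corner b \<and> X = seg 0 b) \<or> (\<exists>a. lower_corner a \<and> X = seg a n) \<or>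
      (\<exists>a b. lower_corner a \<and> upper_corner b \<and> q b + a < p a + b \<and> X = seg a b)"
    using proper_connected_flat_iff[OF conn, of X] X by auto
  moreover have False
    if "lower_corner a" "upper_corner b" "q b + a < p a + b" "X = seg a b" for a b
  proof -
    have "a < b"
    proof (rule ccontr)
      assume "\<not> a < b"
      then have "X = {}" using that by (auto simp: seg_def)
      then show False using xy by auto
    qed
    have bn: "b \<le> n" using that by (auto simp: upper_corner_def)
    \<comment> \<open>The predicate \<open>basis\<close> only asserts maximality; extension turns it
      into a statement on cardinality.\<close>
    obtain B where B: "X \<inter> C \<subseteq> B" "B \<subseteq> X" "indep B" "card B = rank indep X"
      using C(2) by (elim basis_extend[of "X \<inter> C" X, rotated 2]) (auto simp: basis_def restrict_indep_def)
    then have "B = X \<inter> C" using C(2) by (auto simp: basis_def restrict_indep_def)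
    then have "card (C \<inter> seg a b) = min (b - a) (q b - p a)"
      using B(4) rank_seg[of a b] \<open>a < b\<close> bn that(4) by (simp add: Int_commute)
    then show False
      using spanning_circuit_meets_seg[OF C(1) that(1,2) \<open>a < b\<close>] that(3) \<open>a < b\<close> by linarith
  qed
  ultimately show ?R by blast
next
  assume R: ?R
  have n: "2 \<le> n" using R by (auto simp: upper_corner_def lower_corner_def)
  have X: "connected_flat E indep X" "nontrivial indep X"
    using proper_connected_flat_iff[OF conn, of X] R by blast+
  have XE: "X \<subseteq> E" using X(1) by (auto simp: connected_flat_def flat_def)
  have "card X \<noteq> 0" using X(2) indep_empty XE finite_ground
    by (auto simp: nontrivial_def finite_subset)
  moreover have "card X \<noteq> 1"
  proof
    assume "card X = 1"
    then obtain x where x: "X = {x}" by (auto simp: card_1_singleton_iff)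
    have "card (E - {x}) \<noteq> 0" using card_ground n finite_ground x XE by simp
    then obtain y where "y \<in> E" "y \<noteq> x" by (metis Diff_iff card.empty ex_in_conv insertCI)
    then show False using connected_imp_loopless[OF conn, of x y] x XE X(2) by (auto simp: nontrivial_def)
  qed
  ultimately have card_X: "1 < card X" by linarith
  \<comment> \<open>Having the right number of elements is enough: a spanning circuit does not fit
    into \<open>X\<close>, which has smaller rank, so \<open>X \<inter> C\<close> is a proper part
    of \<open>C\<close> and independent.\<close>
  have fund: "fundamental_flat E indep X"
    if less: "rank indep X < rank indep E" and C: "spanning_circuit E indep C"
      and card: "card (C \<inter> X) = rank indep X" for C
  proof -
    have ind: "indep (X \<inter> C)"
    proof -
      have "\<not> C \<subseteq> X"
      proof
        assume "C \<subseteq> X"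
        then have "rank indep C \<le> rank indep X" by (rule rank_mono)
        then show False using less C by (simp add: spanning_circuit_def)
      qed
      then have "X \<inter> C \<subset> C" by auto
      then show ?thesis using C by (simp add: spanning_circuit_def circuit_def)
    qed
    have "basis X (restrict_indep indep X) (X \<inter> C)"
      unfolding basis_def restrict_indep_def
    proof (intro conjI allI impI)
      fix B assume B: "X \<inter> C \<subseteq> B \<and> B \<subseteq> X \<and> B \<subseteq> X \<and> indep B"
      then have "card B \<le> card (X \<inter> C)" using card_le_rank[of B X] card by (simp add: Int_commute)
      then show "B = X \<inter> C" using B indep_finite[of B] card_seteq[of B "X \<inter> C"] by auto
    qed (use ind in auto)
    then show ?thesis unfolding fundamental_flat_def using X card_X less C by blast
  qed
  show ?L
    using R
  proof (elim disjE exE conjE)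
    fix b assume b: "upper_corner b" "X = seg 0 b"
    then have bn: "b < n" "q (Suc b) = Suc (q b)" by (auto simp: upper_corner_def)
    obtain C where "spanning_circuit E indep C" "card (C \<inter> seg 0 b) = q b"
      using spanning_circuit_along_q[OF conn n] bn(1) by metis
    moreover have "q (Suc b) \<le> q n" by (rule q_mono) (use bn in auto)
    ultimately show ?thesis
      using bn b(2) ends_meet by (intro fund[of C]) (auto simp: rank_initial rank_ground)
  next
    fix a assume a: "lower_corner a" "X = seg a n"
    then have an: "0 < a" "a < n" "0 < p a" by (auto simp: lower_corner_def)
    obtain C where "spanning_circuit E indep C" "card (C \<inter> seg a n) = p n - p a"
      using spanning_circuit_along_p[OF conn n] an by (metis less_imp_le)
    moreover have "p a \<le> p n" by (rule p_mono) (use an in auto)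
    ultimately show ?thesis
      using an a(2) by (intro fund[of C]) (auto simp: rank_final rank_ground)
  qed
qed

end

section \<open>The characterization\<close>

text \<open>Indices start at 1, so \<open>h = 0\<close> describes the empty chain.\<close>

lemma finite_chain_enumeration:
  assumes "finite \<C>" "\<And>A B. A \<in> \<C> \<Longrightarrow> B \<in> \<C> \<Longrightarrow> A \<subseteq> B \<or> B \<subseteq> A"
  shows "\<exists>(h::nat) F. strict_mono_on {1..h} F \<and> F ` {1..h} = \<C>"
  using assms
proof (induction "card \<C>" arbitrary: \<C>)
  case 0
  then show ?case by (intro exI[of _ 0]) (auto simp: strict_mono_on_def)
next
  case (Suc c)
  then have "\<C> \<noteq> {}" by auto
  then obtain M where M: "M \<in> \<C>" "\<And>A. A \<in> \<C> \<Longrightarrow> M \<subseteq> A \<Longrightarrow> M = A"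
    using finite_has_maximal[OF Suc.prems(1)] by auto
  have "\<exists>(h::nat) F. strict_mono_on {1..h} F \<and> F ` {1..h} = \<C> - {M}"
  proof (rule Suc.hyps(1))
    show "c = card (\<C> - {M})" using Suc.hyps(2) Suc.prems(1) M(1) by simp
    fix A B assume "A \<in> \<C> - {M}" "B \<in> \<C> - {M}"
    then show "A \<subseteq> B \<or> B \<subseteq> A" using Suc.prems(2)[of A B] by simp
  qed (use Suc.prems(1) in simp)
  then obtain h :: nat and F where F: "strict_mono_on {1..h} F" "F ` {1..h} = \<C> - {M}"
    by (elim exE conjE)
  have below: "F i \<subset> M" if "i \<in> {1..h}" for i
  proof -
    have "F i \<in> F ` {1..h}" using that by (rule imageI)
    then have "F i \<in> \<C>" "F i \<noteq> M" unfolding F(2) by simp_all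
    then show ?thesis using Suc.prems(2)[of "F i" M] M by blast
  qed
  let ?F = "F(Suc h := M)"
  have "strict_mono_on {1..Suc h} ?F"
  proof (rule strict_mono_onI)
    fix i j assume ij: "i \<in> {1..Suc h}" "j \<in> {1..Suc h}" "i < j"
    show "?F i < ?F j"
    proof (cases "j = Suc h")
      case True
      then show ?thesis using ij below[of i] by auto
    next
      case False
      then show ?thesis using ij strict_mono_onD[OF F(1), of i j] by auto
    qed
  qed
  moreover have "?F ` {1..Suc h} = \<C>"
  proof -
    have "{1..Suc h} = insert (Suc h) {1..h}" by auto
    then have "?F ` {1..Suc h} = insert M (F ` {1..h})" by auto
    then show ?thesis using F(2) M(1) by auto
  qed
  ultimately show ?case by blast
qed

lemma (in interval_matroid) flats_structure:
  assumes conn: "connected_matroid E indep"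
  shows "\<exists>(h::nat) (k::nat) (F :: nat \<Rightarrow> 'a set) (G :: nat \<Rightarrow> 'a set).
       (strict_mono_on {1..h} F \<and> strict_mono_on {1..k} G \<and>
        F ` {1..h} \<inter> G ` {1..k} = {} \<and>
        {X. fundamental_flat E indep X} = F ` {1..h} \<union> G ` {1..k}) \<and>
       (\<forall>i\<in>{1..h}. \<forall>j\<in>{1..k}. F i \<inter> G j \<noteq> {} \<longrightarrow> F i \<union> G j = E) \<and>
       {X. connected_flat E indep X \<and> nontrivial indep X \<and> X \<noteq> E} =
         F ` {1..h} \<union> G ` {1..k} \<union>
         {F i \<inter> G j | i j. i \<in> {1..h} \<and> j \<in> {1..k} \<and>
            nullity indep E < nullity indep (F i) + nullity indep (G j)} \<and>
       (\<forall>i\<in>{1..h}. \<forall>j\<in>{1..k}.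
          nullity indep E < nullity indep (F i) + nullity indep (G j) \<longrightarrow>
          int (rank indep (F i \<inter> G j)) =
            int (rank indep (F i)) + int (rank indep (G j)) - int (rank indep E))"
proof -
  let ?U = "{seg 0 b | b. upper_corner b}" and ?L = "{seg a n | a. lower_corner a}"
  have "\<exists>(h::nat) F. strict_mono_on {1..h} F \<and> F ` {1..h} = ?U"
  proof (rule finite_chain_enumeration)
    show "finite ?U"
      by (rule finite_subset[of _ "Pow E"]) (use seg_subset finite_ground in auto)
    fix A B assume "A \<in> ?U" "B \<in> ?U"
    then obtain a b where "A = seg 0 a" "B = seg 0 b" by blast
    then show "A \<subseteq> B \<or> B \<subseteq> A"
      using seg_mono[of 0 0 a b] seg_mono[of 0 0 b a] by (metis le_cases order.refl)
  qed
  then obtain h :: nat and F where F: "strict_mono_on {1..h} F" "F ` {1..h} = ?U"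
    by (elim exE conjE)
  have "\<exists>(k::nat) G. strict_mono_on {1..k} G \<and> G ` {1..k} = ?L"
  proof (rule finite_chain_enumeration)
    show "finite ?L"
      by (rule finite_subset[of _ "Pow E"]) (use seg_subset finite_ground in auto)
    fix A B assume "A \<in> ?L" "B \<in> ?L"
    then obtain a b where "A = seg a n" "B = seg b n" by blast
    then show "A \<subseteq> B \<or> B \<subseteq> A"
      using seg_mono[of a b n n] seg_mono[of b a n n] by (metis le_cases order.refl)
  qed
  then obtain k :: nat and G where G: "strict_mono_on {1..k} G" "G ` {1..k} = ?L"
    by (elim exE conjE)
  \<comment> \<open>Initial segments at upper corners contain the first element, final segments at
    lower corners do not.\<close>
  have disjoint: "?U \<inter> ?L = {}"
  proof -
    have False if ab: "upper_corner b" "lower_corner a" "seg 0 b = seg a n" for a b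
    proof -
      have bn: "0 < b" "b < n" "0 < a" using ab(1,2) by (auto simp: upper_corner_def lower_corner_def)
      then obtain x where x: "x \<in> E" "pos x = 1" using pos_surj[of 1] by auto
      then have "x \<in> seg 0 b" "x \<notin> seg a n" using bn by (auto simp: seg_def)
      then show False using ab(3) by simp
    qed
    then show ?thesis by blast
  qed
  have pair: "(A \<inter> B \<noteq> {} \<longrightarrow> A \<union> B = E) \<and> A \<inter> B = seg a b \<and>
      (nullity indep E < nullity indep A + nullity indep B \<longleftrightarrow> q b + a < p a + b) \<and>
      (q b + a < p a + b \<longrightarrow> int (rank indep (A \<inter> B)) =
        int (rank indep A) + int (rank indep B) - int (rank indep E))"
    if A: "upper_corner b" "A = seg 0 b" and B: "lower_corner a" "B = seg a n" for A B a b
  proof -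
    have abn: "a \<le> n" "b \<le> n" using A(1) B(1) by (auto simp: upper_corner_def lower_corner_def)
    have inter: "A \<inter> B = seg a b" using A B abn by (auto simp: seg_def)
    have union: "A \<union> B = E" if "A \<inter> B \<noteq> {}"
    proof -
      have "a < b" using that unfolding inter by (auto simp: seg_def)
      then show ?thesis using A B pos_range by (auto simp: seg_def)
    qed
    have ranks: "rank indep A = q b" "rank indep B = p n - p a" "rank indep E = p n"
      using A B abn by (simp_all add: rank_initial rank_final rank_ground)
    have cards: "card A = b" "card B = n - a" "card E = n"
      using A B abn by (simp_all add: card_seg card_ground)
    have bounds: "q b \<le> b" "p n \<le> p a + (n - a)" "p a \<le> p n" "p n \<le> n"
      using unit_steps_le[OF q_steps abn(2)] p_bounds[of a n] unit_steps_le[OF p_steps order.refl] abn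
      by simp_all
    \<comment> \<open>The nullities of \<open>E\<close>, \<open>A\<close> and \<open>B\<close> are
      \<open>n - p n\<close>, \<open>b - q b\<close> and \<open>(n - a) - (p n - p a)\<close>; the
      bounds keep all differences from truncating.\<close>
    have nullity_iff: "nullity indep E < nullity indep A + nullity indep B \<longleftrightarrow> q b + a < p a + b"
      unfolding nullity_def ranks cards using bounds abn by linarith
    have rank_inter: "int (rank indep (A \<inter> B)) =
        int (rank indep A) + int (rank indep B) - int (rank indep E)" if dep: "q b + a < p a + b"
    proof -
      have "a < b"
      proof (rule ccontr)
        assume "\<not> a < b"
        then show False using q_bounds[of b a] p_le_q[of a] dep abn by linarith
      qed
      then have "rank indep (A \<inter> B) = min (b - a) (q b - p a)" "p a \<le> q b"
        using rank_seg[of a b] p_le_q[of a] q_mono[of a b] abn by (simp_all add: inter)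
      \<comment> \<open>By \<open>dep\<close> the minimum is \<open>q b - p a\<close>, which equals
        \<open>q b + (p n - p a) - p n\<close>.\<close>
      then show ?thesis unfolding ranks using dep bounds by linarith
    qed
    show ?thesis using union inter nullity_iff rank_inter by blast
  qed
  have F_corner: "\<exists>b. upper_corner b \<and> F i = seg 0 b" if "i \<in> {1..h}" for i
    using F(2) imageI[OF that, of F] by auto
  have G_corner: "\<exists>a. lower_corner a \<and> G j = seg a n" if "j \<in> {1..k}" for j
    using G(2) imageI[OF that, of G] by auto
  have both: "{F i \<inter> G j | i j. i \<in> {1..h} \<and> j \<in> {1..k} \<and>
      nullity indep E < nullity indep (F i) + nullity indep (G j)} =
    {seg a b | a b. lower_corner a \<and> upper_corner b \<and> q b + a < p a + b}"
    (is "?I = ?S")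
  proof (intro equalityI subsetI)
    fix X assume "X \<in> ?I"
    then obtain i j where ij: "X = F i \<inter> G j" "i \<in> {1..h}" "j \<in> {1..k}"
      "nullity indep E < nullity indep (F i) + nullity indep (G j)" by blast
    obtain b where b: "upper_corner b" "F i = seg 0 b" using F_corner[OF ij(2)] by blast
    obtain a where a: "lower_corner a" "G j = seg a n" using G_corner[OF ij(3)] by blast
    show "X \<in> ?S" using pair[OF b a] a b ij by blast
  next
    fix X assume "X \<in> ?S"
    then obtain a b where ab: "X = seg a b" "lower_corner a" "upper_corner b" "q b + a < p a + b"
      by blast
    have "seg 0 b \<in> F ` {1..h}" "seg a n \<in> G ` {1..k}" using F(2) G(2) ab by blast+
    then obtain i j where ij: "i \<in> {1..h}" "F i = seg 0 b" "j \<in> {1..k}" "G j = seg a n"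
      by (metis imageE)
    show "X \<in> ?I" using pair[OF ab(3) ij(2) ab(2) ij(4)] ab ij by blast
  qed
  have i: "{X. fundamental_flat E indep X} = F ` {1..h} \<union> G ` {1..k}"
    unfolding F(2) G(2) using fundamental_flat_iff[OF conn] by blast
  have iii: "{X. connected_flat E indep X \<and> nontrivial indep X \<and> X \<noteq> E} =
      F ` {1..h} \<union> G ` {1..k} \<union> {F i \<inter> G j | i j. i \<in> {1..h} \<and> j \<in> {1..k} \<and>
        nullity indep E < nullity indep (F i) + nullity indep (G j)}"
    unfolding both F(2) G(2) proper_connected_flat_iff[OF conn] by blast
  have ii_iv: "(F i \<inter> G j \<noteq> {} \<longrightarrow> F i \<union> G j = E) \<and>
      (nullity indep E < nullity indep (F i) + nullity indep (G j) \<longrightarrow>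
        int (rank indep (F i \<inter> G j)) =
          int (rank indep (F i)) + int (rank indep (G j)) - int (rank indep E))"
    if ij: "i \<in> {1..h}" "j \<in> {1..k}" for i j
  proof -
    obtain b where b: "upper_corner b" "F i = seg 0 b" using F_corner[OF ij(1)] by blast
    obtain a where a: "lower_corner a" "G j = seg a n" using G_corner[OF ij(2)] by blast
    show ?thesis using pair[OF b a] by blast
  qed
  have disj: "F ` {1..h} \<inter> G ` {1..k} = {}" unfolding F(2) G(2) by (rule disjoint)
  show ?thesis
    by (rule exI[of _ h], rule exI[of _ k], rule exI[of _ F], rule exI[of _ G])
      (use F(1) G(1) disj i iii ii_iv in simp)
qed

theorem theorem5p10:
  fixes E :: "'a set" and indep :: "'a set \<Rightarrow> bool"
  assumes "matroid E indep" and "connected_matroid E indep"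
  shows "lattice_path_matroid E indep \<longleftrightarrow>
    (\<exists>(h::nat) (k::nat) (F :: nat \<Rightarrow> 'a set) (G :: nat \<Rightarrow> 'a set).
       (strict_mono_on {1..h} F \<and> strict_mono_on {1..k} G \<and>
        F ` {1..h} \<inter> G ` {1..k} = {} \<and>
        {X. fundamental_flat E indep X} = F ` {1..h} \<union> G ` {1..k}) \<and>
       (\<forall>i\<in>{1..h}. \<forall>j\<in>{1..k}. F i \<inter> G j \<noteq> {} \<longrightarrow> F i \<union> G j = E) \<and>
       {X. connected_flat E indep X \<and> nontrivial indep X \<and> X \<noteq> E} =
         F ` {1..h} \<union> G ` {1..k} \<union>
         {F i \<inter> G j | i j. i \<in> {1..h} \<and> j \<in> {1..k} \<and>
            nullity indep E < nullity indep (F i) + nullity indep (G j)} \<and>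
       (\<forall>i\<in>{1..h}. \<forall>j\<in>{1..k}.
          nullity indep E < nullity indep (F i) + nullity indep (G j) \<longrightarrow>
          int (rank indep (F i \<inter> G j)) =
            int (rank indep (F i)) + int (rank indep (G j)) - int (rank indep E)))"
  (is "_ \<longleftrightarrow> ?R")
proof -
  interpret matroid E indep by fact
  note conn = \<open>connected_matroid E indep\<close>
  show ?thesis
    unfolding lattice_path_matroid_iff[OF \<open>matroid E indep\<close>]
  proof
    assume "\<exists>pos n p q. interval_matroid E indep pos n p q"
    then obtain pos n p q where "interval_matroid E indep pos n p q" by blast
    then show "?R" by (rule interval_matroid.flats_structure[OF _ conn])
  next
    assume "?R"
    then obtain h k :: nat and F G :: "nat \<Rightarrow> 'a set" where
      F: "strict_mono_on {1..h} F" and G: "strict_mono_on {1..k} G"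
      and fund: "{X. fundamental_flat E indep X} = F ` {1..h} \<union> G ` {1..k}"
      and cross: "\<forall>i\<in>{1..h}. \<forall>j\<in>{1..k}. F i \<inter> G j \<noteq> {} \<longrightarrow> F i \<union> G j = E"
      and flats: "{X. connected_flat E indep X \<and> nontrivial indep X \<and> X \<noteq> E} =
        F ` {1..h} \<union> G ` {1..k} \<union> {F i \<inter> G j | i j. i \<in> {1..h} \<and> j \<in> {1..k} \<and>
          nullity indep E < nullity indep (F i) + nullity indep (G j)}"
      and ranks: "\<forall>i\<in>{1..h}. \<forall>j\<in>{1..k}.
        nullity indep E < nullity indep (F i) + nullity indep (G j) \<longrightarrow>
        int (rank indep (F i \<inter> G j)) =
          int (rank indep (F i)) + int (rank indep (G j)) - int (rank indep E)"
      by (elim exE conjE)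
    have sub: "X \<subseteq> E" if "X \<in> F ` {1..h} \<union> G ` {1..k}" for X
      using that unfolding fund[symmetric]
      by (simp add: fundamental_flat_def connected_flat_def flat_def)
    have chain: "A \<subseteq> B \<or> B \<subseteq> A"
      if H: "strict_mono_on {1..l} H" and AB: "A \<in> H ` {1..l}" "B \<in> H ` {1..l}"
      for l :: nat and H :: "nat \<Rightarrow> 'a set" and A B
    proof -
      obtain i j where ij: "i \<in> {1..l}" "A = H i" "j \<in> {1..l}" "B = H j"
        using AB by (elim imageE) simp
      consider "i < j" | "i = j" | "j < i" by linarith
      then show ?thesis
        using strict_mono_onD[OF H, of i j] strict_mono_onD[OF H, of j i] ij by cases auto
    qed
    show "\<exists>pos n p q. interval_matroid E indep pos n p q"
    proof (rule chains_imp_interval_matroid[OF conn, of "F ` {1..h}" "G ` {1..k}"])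
      fix X assume "connected_flat E indep X" "nontrivial indep X" "X \<noteq> E"
      then have "X \<in> F ` {1..h} \<union> G ` {1..k} \<union> {F i \<inter> G j | i j. i \<in> {1..h} \<and> j \<in> {1..k} \<and>
          nullity indep E < nullity indep (F i) + nullity indep (G j)}"
        unfolding flats[symmetric] by simp
      then consider "X \<in> F ` {1..h}" | "X \<in> G ` {1..k}"
        | i j where "X = F i \<inter> G j" "i \<in> {1..h}" "j \<in> {1..k}"
          "nullity indep E < nullity indep (F i) + nullity indep (G j)" by blast
      then show "X \<in> F ` {1..h} \<or> X \<in> G ` {1..k} \<or> (\<exists>F'\<in>F ` {1..h}. \<exists>G'\<in>G ` {1..k}.
          X = F' \<inter> G' \<and> rank indep X + rank indep E = rank indep F' + rank indep G')"
      proof cases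
        case 3
        then have "int (rank indep X) =
            int (rank indep (F i)) + int (rank indep (G j)) - int (rank indep E)"
          using ranks by blast
        then have "rank indep X + rank indep E = rank indep (F i) + rank indep (G j)" by linarith
        then show ?thesis using 3 by blast
      qed simp_all
    next
      show "F ` {1..h} \<subseteq> Pow E" "G ` {1..k} \<subseteq> Pow E" using sub by (auto simp only: Un_iff Pow_iff)
      show "A \<subseteq> B \<or> B \<subseteq> A" if "A \<in> F ` {1..h}" "B \<in> F ` {1..h}" for A B
        using F that by (rule chain)
      show "A \<subseteq> B \<or> B \<subseteq> A" if "A \<in> G ` {1..k}" "B \<in> G ` {1..k}" for A B
        using G that by (rule chain)
      fix F' G' assume *: "F' \<in> F ` {1..h}" "G' \<in> G ` {1..k}" "F' \<inter> G' \<noteq> {}"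
      obtain i where i: "i \<in> {1..h}" "F' = F i" using *(1) by (rule imageE) simp
      obtain j where j: "j \<in> {1..k}" "G' = G j" using *(2) by (rule imageE) simp
      show "F' \<union> G' = E" using cross i j *(3) by simp
    qed
  qed
qed

end
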